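(* Let $F$ be a finite field of order $q=3^n$, where $n$ is odd and $n>1$, and let $d=3^r+2$, where $r$ is a nonnegative integer with $4r\equiv 1 \pmod{n}$. For $a\in F$ put \[ W_{F,d}(a)=\sum_{x\in F}\psi(x^d-ax), \] where $\psi\colon F\to\mathbb{C}$ is the canonical additive character $\psi(x)=\exp(2\pi i\,\mathrm{Tr}(x)/3)$ and $\mathrm{Tr}\colon F\to\mathbb{F}_3$ is the absolute trace. Then, as $a$ runs through $F^\times=F\setminus\{0\}$, the sum $W_{F,d}(a)$ takes exactly three values: \[ W_{F,d}(a)=\begin{cases} 0 & \text{for exactly } q-q/3-1 \text{ values of } a\in F^\times,\\ +\sqrt{3q} & \text{for exactly } (q+\sqrt{3q})/6 \text{ values of } a\in F^\times,\\ -\sqrt{3q} & \text{for exactly } (q-\sqrt{3q})/6 \text{ values of } a\in F^\times. \end{cases} \]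
   Context: The canonical additive character of a finite field $F$ of characteristic $p$ is $\psi(x)=\exp(2\pi i\,\mathrm{Tr}(x)/p)$, where $\mathrm{Tr}\colon F\to\mathbb{F}_p$ is the absolute trace and $\mathrm{Tr}(x)$ is viewed as an integer in $\{0,\dots,p-1\}$. *)

theory Defs
  imports Complex_Main "HOL-Library.Cardinality" "HOL-Number_Theory.Number_Theory"
begin

text \<open>
  Throughout, the type \<open>'a\<close> is the finite field \<open>F\<close>; \<open>CHAR('a)\<close> is its characteristic \<open>p\<close>,
  which is prime.  The degree of \<open>F\<close> over its prime field is the unique \<open>n\<close> with \<open>|F| = p ^ n\<close>.
\<close>

definition field_degree :: "'a::{field,finite} itself \<Rightarrow> nat" where
  "field_degree _ = (THE n. CARD('a) = CHAR('a) ^ n)"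

text \<open>
  The absolute trace as the sum of the conjugates \<open>x, x ^ p, \<dots>, x ^ (p ^ (n - 1))\<close>.
  Its values lie in the prime field, here the copy of it inside \<open>'a\<close>.
\<close>

definition abs_trace :: "'a::{field,finite} \<Rightarrow> 'a" where
  "abs_trace x = (\<Sum>i<field_degree TYPE('a). x ^ (CHAR('a) ^ i))"

text \<open>The representative of the absolute trace in \<open>{0, \<dots>, p - 1}\<close>.\<close>

definition abs_trace_nat :: "'a::{field,finite} \<Rightarrow> nat" where
  "abs_trace_nat x = (THE k. k < CHAR('a) \<and> of_nat k = abs_trace x)"

definition canonical_char :: "'a::{field,finite} \<Rightarrow> complex" where
  "canonical_char x =
     exp (2 * of_real pi * \<i> * of_nat (abs_trace_nat x) / of_nat CHAR('a))"

definition weil_sum :: "nat \<Rightarrow> 'a::{field,finite} \<Rightarrow> complex" where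
  "weil_sum d a = (\<Sum>x\<in>UNIV. canonical_char (x ^ d - a * x))"

end

theory Submission
  imports Defs "Jordan_Normal_Form.Char_Poly"
begin

text \<open>
  With \<open>Q = 3 ^ r\<close>, the polarization of the cubic form \<open>Tr (x ^ (Q + 2))\<close> turns the fourth moment of the
  Weil sums into \<open>q\<^sup>2\<close> times the number of zeros of \<open>u ^ Q * v + u * v ^ Q + (u * v) ^ (1 / Q)\<close>, which
  reduces to counting the points of a circle, and so \<open>\<Sum> W\<^sup>4 = 3 * q ^ 3\<close>. Together with
  \<open>\<Sum> W\<^sup>2 = q\<^sup>2\<close> this gives \<open>\<Sum> W\<^sup>2 * (W\<^sup>2 - 3 * q) = 0\<close>. The \<open>W a\<close> are integers divisible by
  \<open>sqrt (3 * q)\<close>, so no summand is negative and all of them vanish; the first two moments then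
  determine the frequencies.

  For the divisibility, \<open>W a\<close> is a sum of products of two Gauss sums, and Stickelberger's theorem bounds
  their valuations by base 3 digit sums. What remains is the inequality \<open>s j + s (- d * j) \<ge> n + 1\<close>
  between digit sums, which a potential function on the graph of possible carries proves.
\<close>

section \<open>Reduction of cyclotomic integers modulo a prime above 3\<close>

text \<open>The usual route to Stickelberger's theorem passes through prime ideals of a cyclotomic
  field. Here only the ring \<open>R\<close> of values of integer polynomials at one root of unity
  \<open>z\<close> of order \<open>3 * (q - 1)\<close> is used, with a ring homomorphism
  \<open>red\<close> from \<open>R\<close> onto the given field; it exists because
  \<open>1 - w\<close> is not a unit. Elements outside its kernel act as units, so a valuation bound
  becomes an equation \<open>u * x = lam ^ k * v\<close> with \<open>red u \<noteq> 0\<close>, where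
  \<open>lam = 1 - w\<close> and \<open>lam ^ 2\<close> is \<open>3\<close> up to a unit. The
  congruence \<open>4 * r = 1\<close> modulo \<open>n\<close> acts twice: it makes the fourth power
  of \<open>3 ^ r\<close> congruent to \<open>3\<close> modulo \<open>q - 1\<close>, which settles
  the gcd conditions, and it lets one finite carry graph serve all \<open>n\<close>. The potential
  alone yields only the bound \<open>n\<close> on the two digit sums. Parity raises it to
  \<open>n + 1\<close>, since their sum is even and \<open>n\<close> is odd. This is just enough:
  \<open>lam ^ (n + 1)\<close> is \<open>sqrt (3 * q)\<close> up to a unit, the size at which the
  second and fourth moments leave no room.\<close>

abbreviation ipoly :: "int poly \<Rightarrow> 'b::comm_ring_1 \<Rightarrow> 'b" where
  "ipoly f x \<equiv> poly (map_poly of_int f) x"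

lemma ipoly_simps:
  "ipoly 0 x = 0" "ipoly 1 x = 1" "ipoly (f + g) x = ipoly f x + ipoly g x"
  "ipoly (f - g) x = ipoly f x - ipoly g x" "ipoly (- f) x = - ipoly f x"
  "ipoly (f * g) x = ipoly f x * ipoly g x" "ipoly (f ^ k) x = ipoly f x ^ k"
  "ipoly (smult c f) x = of_int c * ipoly f x" "ipoly [:c:] x = of_int c"
  "ipoly (monom c k) x = of_int c * x ^ k" "ipoly (pCons c f) x = of_int c + x * ipoly f x"
  by (simp_all add: hom_distribs poly_monom map_poly_pCons)

lemma ipoly_X_power_minus_1: "ipoly (monom 1 k - 1) x = x ^ k - 1"
  by (simp add: hom_distribs poly_monom)

lemma ipoly_prod: "ipoly (prod f A) x = (\<Prod>i\<in>A. ipoly (f i) x)"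
  by (induction A rule: infinite_finite_induct) (simp_all add: ipoly_simps)

lemma card_gt_1_UNIV_field: "CARD('a::{field,finite}) > 1"
proof -
  have "card {0, 1 :: 'a} \<le> CARD('a)" by (rule card_mono) auto
  thus ?thesis by simp
qed

lemma finite_field_power_card:
  fixes x :: "'a::{field,finite}"
  assumes "x \<noteq> 0"
  shows "x ^ (CARD('a) - 1) = 1"
proof -
  let ?U = "UNIV - {0::'a}"
  have "bij_betw ((*) x) ?U ?U"
    by (rule bij_betwI[of _ _ _ "\<lambda>y. y / x"]) (use assms in auto)
  hence "(\<Prod>y\<in>?U. y) = (\<Prod>y\<in>?U. x * y)"
    by (rule prod.reindex_bij_betw[symmetric])
  also have "\<dots> = x ^ card ?U * (\<Prod>y\<in>?U. y)" by (simp add: prod.distrib)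
  finally have "(x ^ card ?U - 1) * (\<Prod>y\<in>?U. y) = 0" by (simp add: algebra_simps)
  moreover have "(\<Prod>y\<in>?U. y) \<noteq> 0" by (simp add: prod_zero_iff)
  ultimately show ?thesis by (simp add: card_Diff_subset)
qed

text \<open>Horner's scheme works here because multiplication by \<open>z\<close> shifts the
  coefficients cyclically. The powers of \<open>z\<close> need not be independent, so the
  coefficients are not unique.\<close>

lemma ipoly_root_of_unity_span:
  fixes z :: complex
  assumes "z ^ N = 1" "N > 0"
  shows "\<exists>c::nat \<Rightarrow> int. ipoly f z = (\<Sum>j<N. of_int (c j) * z ^ j)"
proof (induction f)
  case 0
  show ?case by (rule exI[of _ "\<lambda>_. 0"]) simp
next
  case (pCons a f)
  obtain c where c: "ipoly f z = (\<Sum>j<N. of_int (c j) * z ^ j)" using pCons.IH by blast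
  obtain M where M: "N = Suc M" using assms(2) gr0_conv_Suc by blast
  define c' where "c' j = (if j = 0 then c M + a else c (j - 1))" for j
  have "ipoly (pCons a f) z = of_int a + z * (\<Sum>j<Suc M. of_int (c j) * z ^ j)"
    using c by (simp add: ipoly_simps M)
  also have "\<dots> = of_int a + (\<Sum>j<M. of_int (c j) * z ^ Suc j) + of_int (c M) * z ^ N"
    by (simp add: distrib_left sum_distrib_left algebra_simps M)
  also have "\<dots> = (\<Sum>j<Suc M. of_int (c' j) * z ^ j)"
    by (subst sum.lessThan_Suc_shift) (simp add: c'_def assms(1))
  finally show ?case using M by blast
qed

text \<open>Multiplication by \<open>ipoly f z\<close> acts on the spanning powers of
  \<open>z\<close> through an integer matrix, with the vector of these powers as eigenvector. So the
  value is a root of a monic integer characteristic polynomial.\<close>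

lemma algebraic_int_ipoly_root_of_unity:
  fixes z :: complex
  assumes z: "z ^ N = 1" "N > 0"
  shows "algebraic_int (ipoly f z)"
proof -
  have "\<forall>i. \<exists>c::nat \<Rightarrow> int. ipoly (f * monom 1 i) z = (\<Sum>j<N. of_int (c j) * z ^ j)"
    using ipoly_root_of_unity_span[OF z] by blast
  then obtain c :: "nat \<Rightarrow> nat \<Rightarrow> int"
    where c: "\<And>i. ipoly (f * monom 1 i) z = (\<Sum>j<N. of_int (c i j) * z ^ j)" by metis
  define M where "M = mat N N (\<lambda>(i, j). c i j)"
  define A :: "complex mat" where "A = map_mat of_int M"
  have A: "A \<in> carrier_mat N N" by (simp add: A_def M_def)
  define v where "v = vec N (\<lambda>i. z ^ i)"
  have "v \<in> carrier_vec N" by (simp add: v_def)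
  moreover have "v $ 0 \<noteq> (0\<^sub>v N :: complex vec) $ 0" using z(2) by (simp add: v_def)
  hence "v \<noteq> 0\<^sub>v N" by metis
  moreover have "A *\<^sub>v v = ipoly f z \<cdot>\<^sub>v v"
  proof (rule eq_vecI)
    fix i assume "i < dim_vec (ipoly f z \<cdot>\<^sub>v v)"
    hence i: "i < N" by (simp add: v_def)
    have "(A *\<^sub>v v) $ i = (\<Sum>j<N. of_int (c i j) * z ^ j)"
      using i by (simp add: A_def M_def v_def scalar_prod_def atLeast0LessThan)
    also have "\<dots> = ipoly f z * z ^ i" by (simp add: c[symmetric] ipoly_simps poly_monom)
    finally show "(A *\<^sub>v v) $ i = (ipoly f z \<cdot>\<^sub>v v) $ i" using i by (simp add: v_def)
  qed (simp add: A_def M_def v_def)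
  ultimately have "eigenvalue A (ipoly f z)"
    unfolding eigenvalue_def eigenvector_def using A by auto
  hence "poly (char_poly A) (ipoly f z) = 0" using eigenvalue_root_char_poly[OF A] by blast
  moreover have "char_poly A = map_poly of_int (char_poly M)"
    unfolding A_def by (rule of_int_hom.char_poly_hom[of M N]) (simp add: M_def)
  moreover have "lead_coeff (char_poly M) = 1"
    using degree_monic_char_poly[of M N] by (simp add: M_def)
  ultimately show ?thesis unfolding algebraic_int_altdef_ipoly by metis
qed

text \<open>If \<open>1 - w\<close> were invertible in \<open>\<int>[z]\<close>, so would be its
  square \<open>- 3 * w\<close> and hence \<open>3\<close>; then \<open>1 / 3\<close> would be a
  rational algebraic integer.\<close>

lemma one_not_dvd_ipoly:
  fixes z w :: complex
  assumes z: "z ^ N = 1" "N > 0" and w: "w = z ^ m" "1 + w + w ^ 2 = 0"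
  shows "1 \<noteq> (1 - w) * ipoly f z"
proof
  assume *: "1 = (1 - w) * ipoly f z"
  have w2: "w ^ 2 = - 1 - w" using w(2) by (simp add: algebra_simps add_eq_0_iff)
  have "w ^ 3 = w * w ^ 2" by (simp add: power3_eq_cube power2_eq_square)
  also have "\<dots> = w * (- 1 - w)" by (simp only: w2)
  also have "\<dots> = - w - w ^ 2" by (simp add: algebra_simps power2_eq_square)
  also have "\<dots> = 1" by (simp add: w2)
  finally have w3: "w ^ 3 = 1" .
  have "(1 - w) ^ 2 = 1 - 2 * w + w ^ 2" by (simp add: power2_eq_square algebra_simps)
  hence "(1 - w) ^ 2 = - 3 * w" by (simp add: w2)
  hence "- 3 * w * ipoly f z ^ 2 = ((1 - w) * ipoly f z) ^ 2"
    by (simp add: power_mult_distrib)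
  also have "\<dots> = 1" using * by simp
  finally have "ipoly (- (f ^ 2 * monom 1 m)) z = 1 / 3"
    by (simp add: ipoly_simps poly_monom w(1) algebra_simps)
  hence "algebraic_int (1 / 3 :: complex)"
    using algebraic_int_ipoly_root_of_unity[OF z] by metis
  moreover have "(1 / 3 :: complex) \<in> \<rat>" by simp
  ultimately obtain k where "(1 / 3 :: complex) = of_int k"
    using rational_algebraic_int_is_int by (metis Ints_cases)
  hence "(of_int (3 * k) :: complex) = of_int 1" by (simp add: mult.commute)
  hence "3 * k = 1" by (rule of_int_eq_iff[THEN iffD1])
  thus False by presburger
qed


text \<open>Division by the monic polynomial \<open>X ^ (CARD('a) - 1) - 1\<close> leaves a
  remainder of smaller degree that still vanishes on all units; it has too many roots to be nonzero
  over the field.\<close>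

lemma ipoly_vanishing_on_units:
  fixes f :: "int poly"
  assumes "\<And>x::'a::{field,finite}. x \<noteq> 0 \<Longrightarrow> ipoly f x = 0"
  shows "\<exists>g h. f = (monom 1 (CARD('a) - 1) - 1) * g + smult (int CHAR('a)) h"
proof -
  let ?M = "CARD('a) - 1"
  define d :: "int poly" where "d = monom 1 ?M - 1"
  have M: "?M > 0" using card_gt_1_UNIV_field by simp
  have deg: "degree d = ?M" unfolding d_def using M
    by (subst diff_conv_add_uminus, subst degree_add_eq_left) (simp_all add: degree_monom_eq)
  have lc: "coeff d (degree d) = 1" unfolding deg using M by (simp add: d_def)
  have d0: "d \<noteq> 0" using lc by auto
  obtain g r where gr: "pseudo_divmod f d = (g, r)" by force
  have f: "f = d * g + r" using pseudo_divmod(1)[OF d0 gr] lc by simp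
  have r: "r = 0 \<or> degree r < ?M" using pseudo_divmod(2)[OF d0 gr] deg by simp
  have root: "ipoly r x = 0" if "x \<noteq> 0" for x :: 'a
  proof -
    have "ipoly d x = 0" using finite_field_power_card[OF that] by (simp add: d_def ipoly_X_power_minus_1)
    thus ?thesis using assms[OF that] by (simp add: f ipoly_simps)
  qed
  have "map_poly of_int r = (0 :: 'a poly)"
  proof (rule ccontr)
    assume nz: "map_poly of_int r \<noteq> (0 :: 'a poly)"
    hence "degree (map_poly of_int r :: 'a poly) < ?M"
      using r degree_map_poly_le[of "of_int :: int \<Rightarrow> 'a" r] by fastforce
    moreover have "card {x :: 'a. ipoly r x = 0} \<le> degree (map_poly of_int r :: 'a poly)"
      by (rule card_poly_roots_bound[OF nz])
    moreover have "card (UNIV - {0} :: 'a set) \<le> card {x :: 'a. ipoly r x = 0}"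
      using root by (intro card_mono) auto
    ultimately show False by (simp add: card_Diff_subset)
  qed
  hence "int CHAR('a) dvd coeff r i" for i
    by (metis coeff_0 coeff_map_poly of_int_0 of_int_eq_0_iff_char_dvd)
  hence "[:int CHAR('a):] dvd r" by (simp add: const_poly_dvd_iff)
  then obtain h where "r = smult (int CHAR('a)) h" by (auto elim!: dvdE)
  thus ?thesis using f d_def by blast
qed

text \<open>If no unit \<open>c\<close> were a residue of \<open>z\<close>, there would be an integer polynomial that is \<open>1\<close> at \<open>z\<close> and
  vanishes on all units of the field; this would make \<open>1 - w\<close> a unit of \<open>\<int>[z]\<close>.\<close>

lemma exists_reduction:
  fixes z w :: complex
  assumes z: "z ^ (3 * (CARD('a) - 1)) = 1"
    and w: "w = z ^ (CARD('a) - 1)" "1 + w + w ^ 2 = 0"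
    and char: "CHAR('a::{field,finite}) = 3"
  shows "\<exists>c::'a. c \<noteq> 0 \<and> (\<forall>f. ipoly f z = 0 \<longrightarrow> ipoly f c = 0)"
proof (rule ccontr)
  let ?M = "CARD('a) - 1"
  have M: "?M > 0" using card_gt_1_UNIV_field by simp
  assume "\<not> ?thesis"
  hence "\<forall>c::'a. \<exists>f. c \<noteq> 0 \<longrightarrow> ipoly f z = 0 \<and> ipoly f c \<noteq> 0" by blast
  then obtain f where f: "\<And>c::'a. c \<noteq> 0 \<Longrightarrow> ipoly (f c) z = 0 \<and> ipoly (f c) c \<noteq> 0" by metis
  define k where "k = (\<Prod>c\<in>UNIV - {0::'a}. 1 - f c ^ ?M)"
  have "ipoly k x = 0" if "x \<noteq> 0" for x :: 'a
    unfolding k_def ipoly_prod using f[OF that] that finite_field_power_card[of "ipoly (f x) x"]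
    by (intro prod_zero bexI[of _ x]) (simp_all add: ipoly_simps)
  then obtain g h where gh: "k = (monom 1 ?M - 1) * g + smult 3 h"
    using ipoly_vanishing_on_units[where 'a = 'a, of k] char by auto
  have "ipoly k z = 1"
    unfolding k_def ipoly_prod using f M by (intro prod.neutral) (auto simp: ipoly_simps)
  moreover have "ipoly k z = (w - 1) * ipoly g z + 3 * ipoly h z"
    by (simp add: gh ipoly_simps ipoly_X_power_minus_1 w(1) poly_monom)
  \<comment> \<open>By this factorization both summands of \<open>ipoly k z\<close> are multiples of
    \<open>1 - w\<close>, although their sum is \<open>1\<close>.\<close>
  moreover have "3 = (1 - w) * (2 + w)" using w(2) by (simp add: algebra_simps power2_eq_square)
  ultimately have "1 = (1 - w) * ipoly ([:2:] * h + monom 1 ?M * h - g) z"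
    by (simp add: ipoly_simps poly_monom w(1) algebra_simps)
  thus False using one_not_dvd_ipoly[OF z _ w] M by auto
qed


lemma sum_cube_roots_of_unity: "1 + cis (2 * pi / 3) + cis (2 * pi / 3) ^ 2 = 0"
proof -
  let ?w = "cis (2 * pi / 3)"
  have "?w \<noteq> 1" by (simp add: complex_eq_iff cos_120)
  moreover have "(?w - 1) * (1 + ?w + ?w ^ 2) = ?w ^ 3 - 1"
    by (simp add: algebra_simps power2_eq_square power3_eq_cube)
  moreover have "?w ^ 3 = 1" unfolding DeMoivre by simp
  ultimately show ?thesis by simp
qed

lemma CHAR_eq_3:
  assumes "CARD('a::{field,finite}) = 3 ^ n"
  shows "CHAR('a) = 3"
proof -
  have "prime CHAR('a)" "CHAR('a) dvd 3 ^ n"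
    using CHAR_dvd_CARD[where 'a = 'a] assms finite_imp_CHAR_pos[where 'a = 'a]
    by (auto intro!: prime_CHAR_semidom)
  moreover have "prime (3 :: nat)" by simp
  ultimately show ?thesis by (metis prime_dvd_power primes_dvd_imp_eq)
qed

text \<open>The order \<open>3 * (q - 1)\<close> is chosen so that the values of the additive
  character, which are cube roots of unity, and those of the multiplicative characters, of order
  dividing \<open>q - 1\<close>, are all powers of this one number.\<close>

lemma exists_residue:
  assumes "CARD('a::{field,finite}) = q" "q = 3 ^ n"
  shows "\<exists>c::'a. c \<noteq> 0 \<and> (\<forall>f. ipoly f (cis (2 * pi / (3 * real (q - 1)))) = 0 \<longrightarrow> ipoly f c = 0)"
proof -
  have q: "q - 1 > 0" using card_gt_1_UNIV_field[where 'a = 'a] assms by simp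
  let ?z = "cis (2 * pi / (3 * real (q - 1)))"
  have "?z ^ (3 * (q - 1)) = cis (2 * pi)"
    using q unfolding DeMoivre by (intro arg_cong[of _ _ cis]) (simp add: field_simps)
  moreover have "cis (2 * pi / 3) = ?z ^ (q - 1)"
    using q unfolding DeMoivre by (intro arg_cong[of _ _ cis]) (simp add: field_simps)
  ultimately show ?thesis
    using exists_reduction[where 'a = 'a, of ?z] sum_cube_roots_of_unity CHAR_eq_3[where 'a = 'a] assms by simp
qed

text \<open>The second assumption on \<open>c\<close> says that evaluating a polynomial at
  \<open>c\<close> depends only on its value at the complex root of unity. So \<open>c\<close> is
  the residue of that root modulo a prime above 3.\<close>

locale teichmueller =
  fixes c :: "'a::{field,finite}" and n q :: nat
  assumes card_field: "CARD('a) = q" and q: "q = 3 ^ n" and n: "n > 1"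
    and c: "c \<noteq> 0" "\<And>f. ipoly f (cis (2 * pi / (3 * real (q - 1)))) = 0 \<Longrightarrow> ipoly f c = 0"
begin

definition z :: complex where "z = cis (2 * pi / (3 * real (q - 1)))"

definition w :: complex where "w = cis (2 * pi / 3)"

lemma q_gt: "q \<ge> 9"
  using n power_increasing[of 2 n "3::nat"] by (simp add: q)

lemma w: "w = z ^ (q - 1)"
  using q_gt unfolding w_def z_def DeMoivre by (intro arg_cong[of _ _ cis]) (simp add: field_simps)

lemma w3: "w ^ 3 = 1"
  unfolding w_def DeMoivre by simp

lemma w_sum: "1 + w + w ^ 2 = 0"
  unfolding w_def by (rule sum_cube_roots_of_unity)

lemma z3_power: "(z ^ 3) ^ k = cis (2 * pi * real k / real (q - 1))"
  using q_gt unfolding power_mult[symmetric] z_def DeMoivre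
  by (intro arg_cong[of _ _ cis]) (simp add: field_simps)

lemma z_primitive:
  assumes "0 < k" "k < q - 1"
  shows "(z ^ 3) ^ k \<noteq> 1"
proof
  assume *: "(z ^ 3) ^ k = 1"
  have "inj_on (\<lambda>k. cis (2 * pi * real k / real (q - 1))) {..<q - 1}"
    using bij_betw_roots_unity[of "q - 1"] assms by (auto simp: bij_betw_def)
  hence "k = 0" by (rule inj_onD) (use * assms z3_power in auto)
  thus False using assms by simp
qed

lemma z: "(z ^ 3) ^ (q - 1) = 1"
  using q_gt by (simp add: z3_power)

definition R :: "complex set" where "R = range (\<lambda>f. ipoly f z)"

text \<open>The polynomial chosen does not matter: two choices differ by one that vanishes at
  \<open>z\<close>, hence at \<open>c\<close>.\<close>

definition red :: "complex \<Rightarrow> 'a" where "red x = ipoly (SOME f. ipoly f z = x) c"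

lemma red_ipoly: "red (ipoly f z) = ipoly f c"
proof -
  define g where "g = (SOME g. ipoly g z = ipoly f z)"
  have "ipoly g z = ipoly f z" unfolding g_def by (rule someI) (rule refl)
  hence "ipoly (g - f) z = 0" by (simp add: ipoly_simps)
  hence "ipoly (g - f) c = 0" unfolding z_def by (rule c(2))
  thus ?thesis by (simp add: red_def g_def ipoly_simps)
qed

lemma R_ipoly [simp]: "ipoly f z \<in> R" by (simp add: R_def)

lemma R_cases [elim]: assumes "x \<in> R" obtains f where "x = ipoly f z"
  using assms by (auto simp: R_def)

lemma R_add [intro]: "x \<in> R \<Longrightarrow> y \<in> R \<Longrightarrow> x + y \<in> R"
  by (metis R_cases R_ipoly ipoly_simps(3))

lemma R_diff [intro]: "x \<in> R \<Longrightarrow> y \<in> R \<Longrightarrow> x - y \<in> R"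
  by (metis R_cases R_ipoly ipoly_simps(4))

lemma R_uminus [intro]: "x \<in> R \<Longrightarrow> - x \<in> R"
  by (metis R_cases R_ipoly ipoly_simps(5))

lemma R_mult [intro]: "x \<in> R \<Longrightarrow> y \<in> R \<Longrightarrow> x * y \<in> R"
  by (metis R_cases R_ipoly ipoly_simps(6))

lemma R_power [intro]: "x \<in> R \<Longrightarrow> x ^ k \<in> R"
  by (metis R_cases R_ipoly ipoly_simps(7))

lemma R_of_int [intro, simp]: "of_int k \<in> R"
  by (metis R_ipoly ipoly_simps(9))

lemma R_of_nat [intro, simp]: "of_nat k \<in> R"
  using R_of_int[of "int k"] by simp

lemma R_0 [intro, simp]: "0 \<in> R" and R_1 [intro, simp]: "1 \<in> R"
  and R_numeral [intro, simp]: "numeral m \<in> R"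
  using R_of_int[of 0] R_of_int[of 1] R_of_nat[of "numeral m"] by simp_all

lemma R_z [intro, simp]: "z \<in> R"
  using R_ipoly[of "monom 1 1"] by (simp add: ipoly_simps poly_monom)

lemma R_w [intro, simp]: "w \<in> R"
  by (simp add: w R_power)

lemma R_sum [intro]: "(\<And>i. i \<in> A \<Longrightarrow> f i \<in> R) \<Longrightarrow> sum f A \<in> R"
  by (induction A rule: infinite_finite_induct) auto

lemma red_add: "x \<in> R \<Longrightarrow> y \<in> R \<Longrightarrow> red (x + y) = red x + red y"
  by (metis R_cases red_ipoly ipoly_simps(3))

lemma red_diff: "x \<in> R \<Longrightarrow> y \<in> R \<Longrightarrow> red (x - y) = red x - red y"
  by (metis R_cases red_ipoly ipoly_simps(4))

lemma red_uminus: "x \<in> R \<Longrightarrow> red (- x) = - red x"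
  by (metis R_cases red_ipoly ipoly_simps(5))

lemma red_mult: "x \<in> R \<Longrightarrow> y \<in> R \<Longrightarrow> red (x * y) = red x * red y"
  by (metis R_cases red_ipoly ipoly_simps(6))

lemma red_power: "x \<in> R \<Longrightarrow> red (x ^ k) = red x ^ k"
  by (metis R_cases red_ipoly ipoly_simps(7))

lemma red_of_int [simp]: "red (of_int k) = of_int k"
  by (metis red_ipoly ipoly_simps(9))

lemma red_of_nat [simp]: "red (of_nat k) = of_nat k"
  using red_of_int[of "int k"] by simp

lemma red_0 [simp]: "red 0 = 0" and red_1 [simp]: "red 1 = 1"
  using red_of_int[of 0] red_of_int[of 1] by simp_all

lemma red_z [simp]: "red z = c"
  using red_ipoly[of "monom 1 1"] by (simp add: ipoly_simps poly_monom)

lemma red_sum: "(\<And>i. i \<in> A \<Longrightarrow> f i \<in> R) \<Longrightarrow> red (sum f A) = (\<Sum>i\<in>A. red (f i))"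
  by (induction A rule: infinite_finite_induct) (auto simp: red_add R_sum)

lemma char_3: "CHAR('a) = 3"
  using CHAR_eq_3[where 'a = 'a] card_field q by simp

lemma three_eq_0: "(3 :: 'a) = 0"
  using of_nat_CHAR[where 'a = 'a] by (simp add: char_3)

lemma of_nat_q_eq_0: "of_nat q = (0 :: 'a)"
  using n by (simp add: q three_eq_0)

lemma of_nat_q_1: "of_nat (q - 1) = (- 1 :: 'a)"
proof -
  have "(of_nat q :: 'a) = of_nat (Suc (q - 1))" using q_gt by simp
  also have "\<dots> = of_nat (q - 1) + 1" by simp
  finally have "(of_nat q :: 'a) = of_nat (q - 1) + 1" .
  thus ?thesis by (simp add: of_nat_q_eq_0 eq_neg_iff_add_eq_0)
qed

text \<open>Thus \<open>1 - w\<close> lies in the kernel of \<open>red\<close>, and its powers can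
  measure divisibility.\<close>

lemma red_w [simp]: "red w = 1"
  using finite_field_power_card[OF c(1)] card_field by (simp add: w red_power)

text \<open>If \<open>\<rho>\<close> is a nontrivial root of unity of order dividing \<open>q - 1\<close>, then \<open>\<rho> - 1\<close> divides the unit
  \<open>q - 1\<close>, because \<open>(\<rho> - 1) \<Sum> i \<rho>\<^sup>i = q - 1\<close>.\<close>

lemma red_primitive:
  assumes "0 < k" "k < q - 1"
  shows "(c ^ 3) ^ k \<noteq> 1"
proof -
  define x where "x = (z ^ 3) ^ k"
  have xR: "x \<in> R" by (auto simp: x_def)
  have xM: "x ^ (q - 1) = 1"
    unfolding x_def using z by (metis power_mult mult.commute power_one)
  have x1: "x \<noteq> 1" using z_primitive[OF assms] by (simp add: x_def)
  have *: "(x - 1) * (\<Sum>i<m. of_nat i * x ^ i) = of_nat m * x ^ m - (\<Sum>i<m. x ^ Suc i)" for m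
    by (induction m) (simp_all add: algebra_simps)
  have "(x - 1) * (\<Sum>i<q - 1. x ^ i) = 0" using xM power_diff_1_eq[of x "q - 1"] by simp
  hence "(\<Sum>i<q - 1. x ^ i) = 0" using x1 by simp
  hence "(\<Sum>i<q - 1. x ^ Suc i) = 0" by (simp flip: sum_distrib_left)
  hence "(x - 1) * (\<Sum>i<q - 1. of_nat i * x ^ i) = of_nat (q - 1)" using *[of "q - 1"] xM by simp
  hence "red (x - 1) * red (\<Sum>i<q - 1. of_nat i * x ^ i) = of_nat (q - 1)"
    using xR by (subst red_mult[symmetric]) (auto simp del: of_nat_diff)
  moreover have "of_nat (q - 1) \<noteq> (0 :: 'a)" by (simp only: of_nat_q_1) simp
  ultimately have "red (x - 1) \<noteq> 0" by auto
  thus ?thesis using xR by (simp add: red_diff x_def red_power R_power)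
qed

end

section \<open>Trace and additive character\<close>

context teichmueller
begin

lemma prime_char: "prime CHAR('a)"
  by (simp add: char_3)

lemma frobenius_add: "(x + y :: 'a) ^ (3 ^ i) = x ^ (3 ^ i) + y ^ (3 ^ i)"
  by (rule freshmans_dream'[OF prime_char]) (simp add: char_3)

lemma frobenius_sum: "sum f A ^ (3 ^ i) = (\<Sum>x\<in>A. (f x :: 'a) ^ (3 ^ i))"
  by (rule freshmans_dream_sum'[OF prime_char]) (simp add: char_3)

lemma power_q_1: "x \<noteq> 0 \<Longrightarrow> (x :: 'a) ^ (q - 1) = 1"
  using finite_field_power_card[of x] card_field by simp

lemma power_q [simp]: "(x :: 'a) ^ q = x"
proof (cases "x = 0")
  case False
  have "x ^ q = x ^ (q - 1) * x" using q_gt by (metis power_minus_mult not_less_eq_eq less_le_trans zero_less_numeral)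
  thus ?thesis using power_q_1[OF False] by simp
qed (use q_gt in auto)

lemma field_degree: "field_degree TYPE('a) = n"
  unfolding field_degree_def using card_field q by (intro the_equality) (auto simp: char_3)

lemma trace_altdef: "abs_trace x = (\<Sum>i<n. (x :: 'a) ^ (3 ^ i))"
  by (simp add: abs_trace_def field_degree char_3)

lemma trace_add: "abs_trace (x + y :: 'a) = abs_trace x + abs_trace y"
  by (simp add: trace_altdef frobenius_add sum.distrib)

lemma trace_uminus: "abs_trace (- x :: 'a) = - abs_trace x"
  using trace_add[of x "- x"] trace_add[of 0 0] by (simp add: eq_neg_iff_add_eq_0 add.commute)

text \<open>Cubing permutes the conjugates cyclically, since \<open>x ^ q = x\<close> brings the
  last one back to the first.\<close>

lemma trace_cube: "abs_trace (x ^ 3 :: 'a) = abs_trace x" "(abs_trace x :: 'a) ^ 3 = abs_trace x"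
proof -
  obtain m where m: "n = Suc m" using n by (cases n) auto
  have *: "(\<Sum>i<n. x ^ (3 ^ Suc i)) = abs_trace x"
  proof -
    have "(\<Sum>i<n. x ^ (3 ^ Suc i)) = (\<Sum>i<m. x ^ (3 ^ Suc i)) + x ^ q"
      unfolding m q by simp
    also have "\<dots> = abs_trace x"
      unfolding trace_altdef m by (subst sum.lessThan_Suc_shift) (simp add: power_q)
    finally show ?thesis .
  qed
  show "abs_trace (x ^ 3) = abs_trace x"
    unfolding *[symmetric] unfolding trace_altdef by (simp flip: power_mult)
  show "(abs_trace x) ^ 3 = abs_trace x"
    using frobenius_sum[of "\<lambda>i. x ^ (3 ^ i)" "{..<n}" 1]
      *[unfolded trace_altdef]
    by (simp add: trace_altdef mult.commute flip: power_mult)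
qed

lemma of_nat_eq_iff_mod_3: "of_nat i = (of_nat j :: 'a) \<longleftrightarrow> i mod 3 = j mod 3"
  by (simp add: of_nat_eq_iff_cong_CHAR char_3 cong_def)

text \<open>A trace is fixed by cubing, so it is a root of \<open>t ^ 3 - t\<close>, that is,
  \<open>0\<close>, \<open>1\<close> or \<open>- 1\<close>. Hence exactly one number fits the
  definite description in \<open>abs_trace_nat\<close>.\<close>

lemma trace_nat: "abs_trace_nat x < 3" "of_nat (abs_trace_nat x) = abs_trace (x :: 'a)"
proof -
  let ?t = "abs_trace x"
  have "?t * (?t - 1) * (?t + 1) = ?t ^ 3 - ?t" by (simp add: algebra_simps power3_eq_cube)
  hence "?t = 0 \<or> ?t = 1 \<or> ?t = - 1" by (auto simp: trace_cube eq_neg_iff_add_eq_0)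
  moreover have "(2 :: 'a) = - 1" using three_eq_0 by (simp add: eq_neg_iff_add_eq_0)
  ultimately have "\<exists>k<3. of_nat k = ?t"
    by (auto intro: exI[of _ 0] exI[of _ 1] exI[of _ 2])
  moreover have "i = j" if "i < 3" "j < 3" "of_nat i = ?t" "of_nat j = ?t" for i j
    using that of_nat_eq_iff_mod_3[of i j] by simp
  ultimately have "\<exists>!k. k < 3 \<and> of_nat k = ?t" by blast
  from theI'[OF this] show "abs_trace_nat x < 3" "of_nat (abs_trace_nat x) = ?t"
    unfolding abs_trace_nat_def char_3 by auto
qed

abbreviation \<psi> :: "'a \<Rightarrow> complex" where "\<psi> \<equiv> canonical_char"

lemma psi_altdef: "\<psi> x = w ^ abs_trace_nat x"
proof -
  have "w ^ abs_trace_nat x = cis (real (abs_trace_nat x) * (2 * pi / 3))"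
    by (simp only: w_def DeMoivre)
  thus ?thesis by (simp add: canonical_char_def cis_conv_exp char_3 mult_ac)
qed

lemma w_power_cong: "i mod 3 = j mod 3 \<Longrightarrow> w ^ i = w ^ j"
  by (metis w3 power_mult power_one mult_1 power_add mult_div_mod_eq)

lemma psi_add: "\<psi> (x + y) = \<psi> x * \<psi> y"
proof -
  have "of_nat (abs_trace_nat (x + y)) = (of_nat (abs_trace_nat x + abs_trace_nat y) :: 'a)"
    by (simp add: trace_nat trace_add)
  thus ?thesis unfolding psi_altdef power_add[symmetric] of_nat_eq_iff_mod_3 by (rule w_power_cong)
qed

lemma psi_eqI: "abs_trace x = abs_trace y \<Longrightarrow> \<psi> x = \<psi> y"
  by (simp add: canonical_char_def abs_trace_nat_def)

lemma psi_0 [simp]: "\<psi> 0 = 1"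
proof -
  have "\<psi> 0 * \<psi> 0 = \<psi> 0" "\<psi> 0 \<noteq> 0" by (simp_all add: psi_add[symmetric]) (simp add: psi_altdef w_def)
  thus ?thesis by simp
qed

lemma psi_frobenius: "\<psi> (x ^ (3 ^ i)) = \<psi> x"
proof (induction i)
  case (Suc i)
  have "\<psi> (x ^ (3 ^ Suc i)) = \<psi> ((x ^ (3 ^ i)) ^ 3)" by (simp add: power_mult[symmetric] mult.commute)
  also have "\<dots> = \<psi> (x ^ (3 ^ i))" by (intro psi_eqI trace_cube)
  finally show ?case using Suc by simp
qed simp

text \<open>Otherwise the trace, a nonzero polynomial of degree at most \<open>3 ^ (n - 1)\<close>,
  would vanish at all \<open>q\<close> elements.\<close>

lemma exists_psi_ne_1: "\<exists>x. \<psi> x \<noteq> 1"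
proof (rule ccontr)
  assume "\<not> ?thesis"
  hence psi: "\<psi> x = 1" for x by blast
  have w: "w \<noteq> 1" using w_sum by auto
  moreover have "w ^ 2 \<noteq> 1"
  proof
    assume "w ^ 2 = 1"
    hence "w ^ 3 = w" by (simp add: power3_eq_cube power2_eq_square)
    thus False using w3 w by simp
  qed
  ultimately have w: "w \<noteq> 1" "w ^ 2 \<noteq> 1" .
  have "abs_trace_nat x = 0" for x :: 'a
  proof -
    have "abs_trace_nat x = 0 \<or> abs_trace_nat x = 1 \<or> abs_trace_nat x = 2" using trace_nat(1)[of x] by linarith
    thus ?thesis using psi[of x] w by (auto simp: psi_altdef)
  qed
  hence tr: "abs_trace x = 0" for x :: 'a using trace_nat(2)[of x] by simp
  define f :: "'a poly" where "f = (\<Sum>i<n. monom 1 (3 ^ i))"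
  have "coeff f (3 ^ i) = (\<Sum>j<n. if j = i then 1 else 0)" for i
    by (simp add: f_def coeff_sum coeff_monom)
  from this[of 0] have "coeff f 1 = 1" using n by simp
  hence f0: "f \<noteq> 0" by auto
  have deg: "degree f \<le> 3 ^ (n - 1)" unfolding f_def
    by (intro degree_sum_le) (auto intro!: order.trans[OF degree_monom_le] power_increasing)
  have "poly f x = abs_trace x" for x by (simp add: f_def poly_sum poly_monom trace_altdef)
  hence "card {x. poly f x = 0} = q" using tr card_field by simp
  hence "q \<le> 3 ^ (n - 1)" using card_poly_roots_bound[OF f0] deg by simp
  moreover have "(3::nat) ^ (n - 1) < q" unfolding q using n by (intro power_strict_increasing) auto
  ultimately show False by simp
qed

lemma sum_psi_eq_0: "(\<Sum>x\<in>UNIV. \<psi> x) = 0"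
proof -
  obtain y where y: "\<psi> y \<noteq> 1" using exists_psi_ne_1 by blast
  have "(\<Sum>x\<in>UNIV. \<psi> x) = (\<Sum>x\<in>UNIV. \<psi> (x + y))"
    by (rule sum.reindex_bij_witness[of _ "\<lambda>x. x + y" "\<lambda>x. x - y"]) auto
  also have "\<dots> = (\<Sum>x\<in>UNIV. \<psi> x) * \<psi> y" by (simp add: psi_add sum_distrib_right)
  finally show ?thesis using y by (simp add: mult_left_cancel)
qed

lemma sum_psi_mult: "(\<Sum>x\<in>UNIV. \<psi> (a * x)) = (if a = 0 then of_nat q else 0)"
proof (cases "a = 0")
  case False
  have "(\<Sum>x\<in>UNIV. \<psi> (a * x)) = (\<Sum>x\<in>UNIV. \<psi> x)"
    by (rule sum.reindex_bij_witness[of _ "\<lambda>x. x / a" "\<lambda>x. a * x"]) (use False in auto)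
  thus ?thesis using False sum_psi_eq_0 by simp
qed (simp add: card_field)

end

section \<open>Base 3 digit sums\<close>

function digit_sum :: "nat \<Rightarrow> nat" where
  "digit_sum k = (if k = 0 then 0 else k mod 3 + digit_sum (k div 3))"
  by auto
termination by (relation "measure id") auto

declare digit_sum.simps [simp del]

lemma digit_sum_0 [simp]: "digit_sum 0 = 0"
  by (simp add: digit_sum.simps)

lemma digit_sum_rec: "digit_sum k = k mod 3 + digit_sum (k div 3)"
  by (cases "k = 0") (simp_all add: digit_sum.simps[of k])

lemma digit_sum_mult_3: "digit_sum (3 * k) = digit_sum k"
  by (subst digit_sum_rec) simp

text \<open>Raising the last digit causes no carry. With \<open>digit_sum_mult_3\<close> this
  reduces an induction on \<open>j\<close> to two moves, multiplying by 3 and adding 1, both of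
  which Gauss sums can follow.\<close>

lemma digit_sum_Suc: "\<not> 3 dvd Suc k \<Longrightarrow> digit_sum (Suc k) = Suc (digit_sum k)"
proof -
  assume "\<not> 3 dvd Suc k"
  hence "Suc k mod 3 = Suc (k mod 3)" "Suc k div 3 = k div 3" by presburger+
  thus ?thesis by (subst (1 2) digit_sum_rec) simp
qed

text \<open>All digits of \<open>3 ^ m - 1\<close> are \<open>2\<close>, so the subtraction never
  borrows and each pair of digits adds up to \<open>2\<close>.\<close>

lemma digit_sum_complement: "k < 3 ^ m \<Longrightarrow> digit_sum (3 ^ m - 1 - k) + digit_sum k = 2 * m"
proof (induction m arbitrary: k)
  case (Suc m)
  have "k = 3 * (k div 3) + k mod 3" by simp
  moreover have "k mod 3 < 3" "k div 3 < 3 ^ m" using Suc.prems by auto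
  moreover define a b where "a = 3 ^ m - 1 - k div 3" and "b = 2 - k mod 3"
  ultimately have ab: "3 ^ Suc m - 1 - k = 3 * a + b" "b < 3"
    unfolding power_Suc by linarith+
  have "(3 ^ Suc m - 1 - k) mod 3 = b" "(3 ^ Suc m - 1 - k) div 3 = a"
    unfolding ab(1) using ab(2) by simp_all
  moreover have "k div 3 < 3 ^ m" using Suc.prems by auto
  ultimately have "digit_sum (3 ^ Suc m - 1 - k) + digit_sum k =
      (2 - k mod 3) + k mod 3 + (digit_sum (3 ^ m - 1 - k div 3) + digit_sum (k div 3))"
    using digit_sum_rec[of "3 ^ Suc m - 1 - k"] digit_sum_rec[of k] unfolding a_def b_def by simp
  also have "\<dots> = 2 + 2 * m"
    by (subst Suc.IH) (use Suc.prems in auto)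
  finally show ?case by simp
qed simp

section \<open>Gauss sums\<close>

context teichmueller
begin

text \<open>The residue of the primitive root of unity \<open>\<zeta>\<close> below. As
  \<open>red\<close> preserves its order, \<open>g\<close> generates the multiplicative group of the
  field.\<close>

definition g :: 'a where "g = c ^ 3"

definition \<zeta> :: complex where "\<zeta> = z ^ 3"

lemma g_nonzero [simp]: "g \<noteq> 0"
  using c by (simp add: g_def)

lemma zeta_R [simp, intro]: "\<zeta> \<in> R" and red_zeta [simp]: "red \<zeta> = g"
  by (auto simp: \<zeta>_def g_def red_power)

lemma zeta_q_1: "\<zeta> ^ (q - 1) = 1"
  using z by (simp add: \<zeta>_def)

lemma g_power_eq_iff: "g ^ i = g ^ j \<longleftrightarrow> i mod (q - 1) = j mod (q - 1)"
proof -
  have *: "g ^ k = g ^ (k mod (q - 1))" for k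
    using power_q_1[OF g_nonzero] by (metis mult_1 mult_div_mod_eq power_add power_mult power_one)
  have neq: "g ^ i \<noteq> g ^ j" if "i < j" "j < q - 1" for i j
  proof -
    have "g ^ j = g ^ i * g ^ (j - i)" using that by (simp flip: power_add)
    moreover have "g ^ (j - i) \<noteq> 1" using red_primitive[of "j - i"] that by (auto simp: g_def)
    ultimately show ?thesis by auto
  qed
  have "i mod (q - 1) < q - 1" for i using q_gt by simp
  hence "g ^ (i mod (q - 1)) = g ^ (j mod (q - 1)) \<longleftrightarrow> i mod (q - 1) = j mod (q - 1)"
    by (metis neq linorder_neqE_nat)
  thus ?thesis using * by metis
qed

lemma g_powers: "(\<lambda>k. g ^ k) ` {..<q - 1} = UNIV - {0}"
proof (rule card_subset_eq)
  have "inj_on (\<lambda>k. g ^ k) {..<q - 1}" by (rule inj_onI) (simp add: g_power_eq_iff)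
  from card_image[OF this] show "card ((\<lambda>k. g ^ k) ` {..<q - 1}) = card (UNIV - {0::'a})"
    by (simp add: card_Diff_subset card_field)
  show "(\<lambda>k. g ^ k) ` {..<q - 1} \<subseteq> UNIV - {0}" by (simp add: image_subset_iff)
qed simp

lemma g_power_cases:
  assumes "x \<noteq> 0" obtains k where "k < q - 1" "x = g ^ k"
proof -
  have "x \<in> (\<lambda>k. g ^ k) ` {..<q - 1}" unfolding g_powers using assms by simp
  thus ?thesis using that by blast
qed

text \<open>The Teichmueller character, the multiplicative section of \<open>red\<close>, extended
  by \<open>0\<close>. The exponent picked matters only modulo the order \<open>q - 1\<close> of
  \<open>\<zeta>\<close>.\<close>

definition \<chi> :: "'a \<Rightarrow> complex" where
  "\<chi> x = (if x = 0 then 0 else \<zeta> ^ (SOME k. g ^ k = x))"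

lemma zeta_power_cong: "i mod (q - 1) = j mod (q - 1) \<Longrightarrow> \<zeta> ^ i = \<zeta> ^ j"
  using zeta_q_1 by (metis mult_1 mult_div_mod_eq power_add power_mult power_one)

lemma chi_g_power: "\<chi> (g ^ k) = \<zeta> ^ k"
proof -
  have "g ^ (SOME j. g ^ j = g ^ k) = g ^ k" by (rule someI) (rule refl)
  hence "\<zeta> ^ (SOME j. g ^ j = g ^ k) = \<zeta> ^ k"
    unfolding g_power_eq_iff by (rule zeta_power_cong)
  thus ?thesis by (simp add: \<chi>_def)
qed

lemma chi_0 [simp]: "\<chi> 0 = 0" and chi_1 [simp]: "\<chi> 1 = 1"
  using chi_g_power[of 0] by (simp_all add: \<chi>_def)

lemma chi_mult: "\<chi> (x * y) = \<chi> x * \<chi> y"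
proof (cases "x = 0 \<or> y = 0")
  case False
  then obtain i j where "x = g ^ i" "y = g ^ j" by (meson g_power_cases)
  thus ?thesis by (simp add: chi_g_power flip: power_add)
qed auto

lemma chi_power: "\<chi> (x ^ k) = \<chi> x ^ k"
  by (induction k) (simp_all add: chi_mult)

lemma chi_R [simp, intro]: "\<chi> x \<in> R" and red_chi [simp]: "red (\<chi> x) = x"
proof -
  show "\<chi> x \<in> R" unfolding \<chi>_def by auto
  show "red (\<chi> x) = x"
  proof (cases "x = 0")
    case False
    then obtain k where "x = g ^ k" by (meson g_power_cases)
    thus ?thesis by (simp add: chi_g_power red_power)
  qed simp
qed

lemma chi_eq_0_iff [simp]: "\<chi> x = 0 \<longleftrightarrow> x = 0"
  by (metis chi_0 red_chi)

lemma chi_power_q_1: "x \<noteq> 0 \<Longrightarrow> \<chi> x ^ (q - 1) = 1"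
  by (metis chi_1 chi_power power_q_1)

lemma chi_inverse: "\<chi> (inverse x) = inverse (\<chi> x)"
proof (cases "x = 0")
  case False
  hence "\<chi> x * \<chi> (inverse x) = 1" by (simp flip: chi_mult)
  thus ?thesis by (metis inverse_unique)
qed simp

abbreviation U :: "'a set" where "U \<equiv> UNIV - {0}"

lemma sum_chi_power: "(\<Sum>x\<in>U. \<chi> x ^ k) = (if (q - 1) dvd k then of_nat (q - 1) else 0)"
proof (cases "(q - 1) dvd k")
  case True
  then obtain m where "k = (q - 1) * m" by auto
  hence "(\<Sum>x\<in>U. \<chi> x ^ k) = (\<Sum>x\<in>U. 1)"
    by (intro sum.cong) (auto simp: power_mult chi_power_q_1[simplified])
  thus ?thesis using True by (simp add: card_Diff_subset card_field)
next
  case False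
  have "g ^ k \<noteq> g ^ 0" using False by (simp only: g_power_eq_iff) (simp add: dvd_eq_mod_eq_0)
  hence ne: "\<chi> g ^ k \<noteq> 1" by (metis chi_1 chi_power power_0 red_chi)
  have "(\<Sum>x\<in>U. \<chi> x ^ k) = (\<Sum>x\<in>U. \<chi> (x * g) ^ k)"
    by (rule sum.reindex_bij_witness[of _ "\<lambda>x. x * g" "\<lambda>x. x / g"]) auto
  also have "\<dots> = (\<Sum>x\<in>U. \<chi> x ^ k) * \<chi> g ^ k"
    by (simp add: chi_mult power_mult_distrib sum_distrib_right)
  finally show ?thesis using ne False by (simp add: mult_left_cancel)
qed

text \<open>With the inverse character the valuation is the digit sum of \<open>j\<close> itself,
  not that of \<open>q - 1 - j\<close>.\<close>

definition gauss_sum :: "nat \<Rightarrow> complex" where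
  "gauss_sum j = (\<Sum>x\<in>U. \<chi> (inverse x) ^ j * \<psi> x)"

lemma chi_power_cong:
  assumes "x \<noteq> 0" "i mod (q - 1) = j mod (q - 1)"
  shows "\<chi> x ^ i = \<chi> x ^ j"
  using chi_power_q_1[OF assms(1)] assms(2)
  by (metis mult_1 mult_div_mod_eq power_add power_mult power_one)

lemma gauss_sum_cong: "i mod (q - 1) = j mod (q - 1) \<Longrightarrow> gauss_sum i = gauss_sum j"
  unfolding gauss_sum_def by (intro sum.cong) (auto intro: chi_power_cong)

lemma psi_R [simp, intro]: "\<psi> x \<in> R"
  by (auto simp: psi_altdef)

lemma gauss_sum_R [simp, intro]: "gauss_sum j \<in> R"
  unfolding gauss_sum_def by auto

lemma cube_bij: "bij_betw (\<lambda>x. x ^ 3) U U"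
proof -
  have "inj_on (\<lambda>x::'a. x ^ 3) U"
  proof (rule inj_onI)
    fix x y :: 'a assume "x ^ 3 = y ^ 3"
    hence "(x - y) ^ 3 = 0" using frobenius_add[of "x - y" y 1] by simp
    thus "x = y" by simp
  qed
  moreover have "(\<lambda>x::'a. x ^ 3) ` U \<subseteq> U" by auto
  ultimately show ?thesis by (simp add: bij_betw_def endo_inj_surj)
qed

text \<open>Cubing permutes the units and preserves \<open>\<psi>\<close>. This is the counterpart
  of \<open>digit_sum_mult_3\<close>.\<close>

lemma gauss_sum_mult_3: "gauss_sum (3 * j) = gauss_sum j"
proof -
  have "gauss_sum (3 * j) = (\<Sum>x\<in>U. \<chi> (inverse (x ^ 3)) ^ j * \<psi> (x ^ 3))"
    unfolding gauss_sum_def using psi_frobenius[of _ 1]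
    by (intro sum.cong) (simp_all add: chi_inverse power_inverse chi_power power_mult)
  also have "\<dots> = gauss_sum j"
    unfolding gauss_sum_def by (rule sum.reindex_bij_betw[OF cube_bij])
  finally show ?thesis .
qed

lemma gauss_sum_twist:
  assumes "t \<noteq> 0"
  shows "(\<Sum>x\<in>U. \<chi> (inverse x) ^ j * \<psi> (t * x)) = \<chi> t ^ j * gauss_sum j"
proof -
  have "(\<Sum>x\<in>U. \<chi> (inverse x) ^ j * \<psi> (t * x)) = (\<Sum>x\<in>U. \<chi> (t * inverse x) ^ j * \<psi> x)"
    by (rule sum.reindex_bij_witness[of _ "\<lambda>x. x / t" "\<lambda>x. t * x"])
      (use assms in \<open>auto simp flip: mult.assoc\<close>)
  thus ?thesis by (simp add: gauss_sum_def chi_mult power_mult_distrib sum_distrib_left mult.assoc)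
qed

text \<open>Substitute \<open>y = t * x\<close>. For \<open>t = - 1\<close> the additive character
  disappears and the first term remains; the other \<open>t\<close> assemble into a Jacobi sum. No
  condition on \<open>j + k\<close> is imposed, so the two cases below are both read off from this
  formula.\<close>

lemma gauss_sum_product:
  "gauss_sum j * gauss_sum k =
     \<chi> (- 1) ^ k * (\<Sum>x\<in>U. \<chi> (inverse x) ^ (j + k)) +
     (\<Sum>t\<in>U - {- 1}. \<chi> (inverse t) ^ k * \<chi> (1 + t) ^ (j + k)) * gauss_sum (j + k)"
proof -
  have "gauss_sum j * gauss_sum k =
      (\<Sum>x\<in>U. \<Sum>y\<in>U. \<chi> (inverse x) ^ j * \<chi> (inverse y) ^ k * \<psi> (x + y))"
    by (simp add: gauss_sum_def sum_product psi_add mult_ac)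
  also have "\<dots> = (\<Sum>x\<in>U. \<Sum>t\<in>U. \<chi> (inverse x) ^ j * \<chi> (inverse (t * x)) ^ k * \<psi> (x + t * x))"
  proof (rule sum.cong[OF refl])
    fix x assume "x \<in> U"
    thus "(\<Sum>y\<in>U. \<chi> (inverse x) ^ j * \<chi> (inverse y) ^ k * \<psi> (x + y)) =
        (\<Sum>t\<in>U. \<chi> (inverse x) ^ j * \<chi> (inverse (t * x)) ^ k * \<psi> (x + t * x))"
      by (intro sum.reindex_bij_witness[of _ "\<lambda>t. t * x" "\<lambda>y. y / x"]) auto
  qed
  also have "\<dots> = (\<Sum>x\<in>U. \<Sum>t\<in>U. \<chi> (inverse t) ^ k * (\<chi> (inverse x) ^ (j + k) * \<psi> ((1 + t) * x)))"
    by (simp add: chi_mult power_mult_distrib power_add algebra_simps)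
  also have "\<dots> = (\<Sum>t\<in>U. \<chi> (inverse t) ^ k * (\<Sum>x\<in>U. \<chi> (inverse x) ^ (j + k) * \<psi> ((1 + t) * x)))"
    by (subst sum.swap) (simp add: sum_distrib_left)
  also have "\<dots> = \<chi> (- 1) ^ k * (\<Sum>x\<in>U. \<chi> (inverse x) ^ (j + k)) +
     (\<Sum>t\<in>U - {- 1}. \<chi> (inverse t) ^ k * (\<Sum>x\<in>U. \<chi> (inverse x) ^ (j + k) * \<psi> ((1 + t) * x)))"
    by (subst sum.remove[of _ "- 1"]) auto
  also have "(\<Sum>t\<in>U - {- 1}. \<chi> (inverse t) ^ k * (\<Sum>x\<in>U. \<chi> (inverse x) ^ (j + k) * \<psi> ((1 + t) * x))) =
      (\<Sum>t\<in>U - {- 1}. \<chi> (inverse t) ^ k * \<chi> (1 + t) ^ (j + k)) * gauss_sum (j + k)"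
    unfolding sum_distrib_right
    by (intro sum.cong refl, subst gauss_sum_twist) (auto simp: eq_neg_iff_add_eq_0 add.commute)
  finally show ?thesis .
qed

lemma sum_chi_inverse_power:
  "(\<Sum>x\<in>U. \<chi> (inverse x) ^ k) = (if (q - 1) dvd k then of_nat (q - 1) else 0)"
proof -
  have "(\<Sum>x\<in>U. \<chi> (inverse x) ^ k) = (\<Sum>x\<in>U. \<chi> x ^ k)"
    by (rule sum.reindex_bij_witness[of _ inverse inverse]) auto
  thus ?thesis by (simp only: sum_chi_power)
qed

text \<open>The quotient is the Jacobi sum, which lies in \<open>R\<close>; the extra term vanishes
  because its character is nontrivial.\<close>

lemma gauss_sum_mult_dvd:
  assumes "\<not> (q - 1) dvd (j + k)"
  shows "\<exists>J\<in>R. gauss_sum j * gauss_sum k = J * gauss_sum (j + k)"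
proof (rule bexI)
  show "(\<Sum>t\<in>U - {- 1}. \<chi> (inverse t) ^ k * \<chi> (1 + t) ^ (j + k)) \<in> R" by (auto intro!: R_sum)
qed (use assms in \<open>simp only: gauss_sum_product sum_chi_inverse_power if_False mult_zero_right add_0_left\<close>)

lemma gauss_sum_0: "gauss_sum 0 = - 1"
  using sum_psi_eq_0 by (simp add: gauss_sum_def sum_diff1)

text \<open>The character of index \<open>j + k\<close> is now trivial: the extra term contributes
  \<open>q - 1\<close>, and the Jacobi sum \<open>- (\<chi> (- 1) ^ k)\<close> times
  \<open>gauss_sum 0 = - 1\<close> supplies the missing one.\<close>

lemma gauss_sum_reflection:
  assumes "\<not> (q - 1) dvd k" "(q - 1) dvd (j + k)"
  shows "gauss_sum j * gauss_sum k = \<chi> (- 1) ^ k * of_nat q"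
proof -
  have jk: "(j + k) mod (q - 1) = 0 mod (q - 1)" using assms(2) by (simp add: dvd_eq_mod_eq_0)
  have "(\<Sum>t\<in>U - {- 1}. \<chi> (inverse t) ^ k * \<chi> (1 + t) ^ (j + k)) = (\<Sum>t\<in>U - {- 1}. \<chi> (inverse t) ^ k)"
  proof (rule sum.cong)
    fix t :: 'a assume "t \<in> U - {- 1}"
    hence "1 + t \<noteq> 0" by (auto simp: add_eq_0_iff)
    from chi_power_cong[OF this jk]
    show "\<chi> (inverse t) ^ k * \<chi> (1 + t) ^ (j + k) = \<chi> (inverse t) ^ k" by simp
  qed simp
  also have "\<dots> = (\<Sum>t\<in>U. \<chi> (inverse t) ^ k) - \<chi> (- 1) ^ k"
    by (subst sum.remove[of U "- 1"]) auto
  also have "\<dots> = - (\<chi> (- 1) ^ k)" using assms(1) by (simp add: sum_chi_inverse_power)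
  finally have "gauss_sum j * gauss_sum k = \<chi> (- 1) ^ k * of_nat (q - 1) + \<chi> (- 1) ^ k"
    using assms(2) gauss_sum_cong[OF jk]
    by (simp only: gauss_sum_product sum_chi_inverse_power if_True gauss_sum_0) simp
  also have "\<dots> = \<chi> (- 1) ^ k * of_nat (Suc (q - 1))" by (simp add: algebra_simps)
  finally show ?thesis using q_gt by simp
qed

end

section \<open>Stickelberger bounds\<close>

context teichmueller
begin

text \<open>The prime element above 3 in \<open>\<int>[w]\<close>. Since
  \<open>lam ^ 2 = - 3 * w\<close>, divisibility by 3 counts twice in powers of
  \<open>lam\<close>.\<close>

definition lam :: complex where "lam = 1 - w"

lemma lam_R [simp, intro]: "lam \<in> R" and red_lam [simp]: "red lam = 0"
  by (auto simp: lam_def red_diff)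

lemma w_sq: "w ^ 2 = - 1 - w"
proof -
  have "w ^ 2 = (1 + w + w ^ 2) - 1 - w" by simp
  also have "\<dots> = - 1 - w" by (simp only: w_sum) simp
  finally show ?thesis .
qed

lemma lam_sq: "lam ^ 2 = 3 * (- w)"
proof -
  have "lam ^ 2 = 1 - 2 * w + w ^ 2" by (simp add: lam_def power2_eq_square algebra_simps)
  thus ?thesis by (simp add: w_sq)
qed

lemma lam_even_power: "lam ^ (2 * m) = 3 ^ m * (- w) ^ m"
  by (simp add: power_mult lam_sq flip: power_mult_distrib)

lemma lam_nonzero [simp]: "lam \<noteq> 0"
proof
  assume "lam = 0"
  hence "w = 1" by (simp add: lam_def)
  thus False using w_sum by simp
qed

text \<open>Binomial expansion of \<open>(1 - lam) ^ t\<close> for \<open>t < 3\<close>, where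
  \<open>t div 2\<close> is the binomial coefficient of \<open>t\<close> over 2.\<close>

lemma psi_lam_expansion:
  "\<psi> x = 1 - lam * of_nat (abs_trace_nat x) + lam ^ 2 * of_nat (abs_trace_nat x div 2)"
proof -
  have "abs_trace_nat x = 0 \<or> abs_trace_nat x = 1 \<or> abs_trace_nat x = 2"
    using trace_nat(1)[of x] by linarith
  thus ?thesis
    by (auto simp: psi_altdef lam_def power2_eq_square algebra_simps)
qed

lemma sum_power_units: "(\<Sum>x\<in>U. x ^ k) = (if (q - 1) dvd k then - 1 else 0)"
proof -
  have "(\<Sum>x\<in>U. x ^ k) = red (\<Sum>x\<in>U. \<chi> x ^ k)"
    by (subst red_sum) (auto simp: red_power)
  thus ?thesis using of_nat_q_1 by (simp add: sum_chi_power)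
qed

text \<open>The conjugate \<open>x ^ (3 ^ i)\<close> contributes the power sum of exponent
  \<open>3 ^ i - 1\<close>, which vanishes unless \<open>q - 1\<close> divides that exponent, so
  only \<open>i = 0\<close> survives.\<close>

lemma sum_inverse_trace: "(\<Sum>x\<in>U. inverse x * abs_trace x) = - 1"
proof -
  have "(\<Sum>x\<in>U. inverse x * abs_trace x) = (\<Sum>x\<in>U. \<Sum>i<n. x ^ (3 ^ i - 1))"
    by (intro sum.cong refl) (auto simp: trace_altdef sum_distrib_left power_diff field_simps intro!: sum.cong)
  also have "\<dots> = (\<Sum>i<n. if (q - 1) dvd (3 ^ i - 1) then - 1 else 0)"
    by (subst sum.swap) (simp only: sum_power_units)
  also have "\<dots> = (\<Sum>i<n. if i = 0 then - 1 else 0)"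
  proof (intro sum.cong refl if_cong)
    fix i assume "i \<in> {..<n}"
    hence "(3::nat) ^ i < q" unfolding q by (intro power_strict_increasing) auto
    moreover have "(3::nat) ^ i > 1" if "i \<noteq> 0"
      using that by (intro one_less_power) auto
    ultimately have "0 < (3::nat) ^ i - 1" "(3::nat) ^ i - 1 < q - 1" if "i \<noteq> 0"
      using that by auto
    thus "((q - 1) dvd (3 ^ i - 1)) = (i = 0)" by (cases "i = 0") (auto simp: nat_dvd_not_less)
  qed
  also have "\<dots> = - 1" using n by simp
  finally show ?thesis .
qed

text \<open>In the expansion by powers of \<open>lam\<close> the constant term is a sum of a
  nontrivial character, hence zero, and \<open>sum_inverse_trace\<close> shows that the linear
  coefficient is nonzero after reduction. The valuation is therefore exactly one.\<close>

lemma gauss_sum_1: "\<exists>u\<in>R. red u \<noteq> 0 \<and> gauss_sum 1 = lam * u"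
proof (intro bexI conjI)
  define a where "a = (\<Sum>x\<in>U. \<chi> (inverse x) * of_nat (abs_trace_nat x))"
  define b where "b = (\<Sum>x\<in>U. \<chi> (inverse x) * of_nat (abs_trace_nat x div 2))"
  have R: "a \<in> R" "b \<in> R" unfolding a_def b_def by auto
  have "\<not> (q - 1) dvd 1" using q_gt by simp
  hence "(\<Sum>x\<in>U. \<chi> (inverse x)) = 0" using sum_chi_inverse_power[of 1] by simp
  moreover have "gauss_sum 1 = (\<Sum>x\<in>U. \<chi> (inverse x)) - lam * a + lam ^ 2 * b"
    unfolding gauss_sum_def a_def b_def sum_distrib_left sum_subtractf[symmetric] sum.distrib[symmetric]
    by (intro sum.cong refl) (subst psi_lam_expansion, simp add: algebra_simps)
  ultimately show "gauss_sum 1 = lam * (lam * b - a)"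
    by (simp add: power2_eq_square algebra_simps)
  show "lam * b - a \<in> R" using R by auto
  have "red a = (\<Sum>x\<in>U. inverse x * abs_trace x)" unfolding a_def
    by (subst red_sum) (auto simp: red_mult trace_nat intro!: sum.cong)
  thus "red (lam * b - a) \<noteq> 0" using R by (subst red_diff) (auto simp: red_mult sum_inverse_trace)
qed

text \<open>The upper bound on the valuation. Adding 1 to the index multiplies by
  \<open>gauss_sum 1\<close> and divides by a Jacobi sum; the cofactor \<open>v\<close> collects
  these Jacobi sums.\<close>

lemma gauss_sum_dvd_lam_power:
  "0 < j \<Longrightarrow> j < q - 1 \<Longrightarrow> \<exists>v\<in>R. \<exists>u\<in>R. red u \<noteq> 0 \<and> gauss_sum j * v = lam ^ digit_sum j * u"
proof (induction j rule: less_induct)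
  case (less j)
  show ?case
  proof (cases "3 dvd j")
    case True
    then obtain i where i: "j = 3 * i" by auto
    thus ?thesis using less.IH[of i] less.prems by (simp add: digit_sum_mult_3 gauss_sum_mult_3)
  next
    case False
    obtain i where i: "j = Suc i" using less.prems gr0_conv_Suc by auto
    obtain u where u: "u \<in> R" "red u \<noteq> 0" "gauss_sum 1 = lam * u" using gauss_sum_1 by blast
    have s: "digit_sum j = Suc (digit_sum i)" using digit_sum_Suc False i by simp
    show ?thesis
    proof (cases "i = 0")
      case True
      thus ?thesis using u i s by (intro bexI[of _ 1] bexI[of _ u]) auto
    next
      case False
      then obtain v u' where v: "v \<in> R" "u' \<in> R" "red u' \<noteq> 0" "gauss_sum i * v = lam ^ digit_sum i * u'"
        using less.IH[of i] less.prems i by auto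
      have "\<not> (q - 1) dvd (i + 1)" using less.prems i by (auto dest: dvd_imp_le)
      then obtain J where J: "J \<in> R" "gauss_sum i * gauss_sum 1 = J * gauss_sum j"
        using gauss_sum_mult_dvd[of i 1] i by auto
      have "gauss_sum j * (J * v) = (gauss_sum i * v) * gauss_sum 1" using J(2) by (simp add: mult_ac)
      also have "\<dots> = lam ^ digit_sum j * (u * u')" unfolding v(4) u(3) s by simp
      finally show ?thesis using v u J
        by (intro bexI[of _ "J * v"] bexI[of _ "u * u'"]) (auto simp: red_mult)
    qed
  qed
qed

text \<open>Divisibility by \<open>lam ^ k\<close> in the localization of \<open>R\<close> at the
  kernel of \<open>red\<close>, with \<open>u\<close> as denominator.\<close>

definition lam_dvd :: "nat \<Rightarrow> complex \<Rightarrow> bool" where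
  "lam_dvd k x \<longleftrightarrow> (\<exists>u\<in>R. \<exists>v\<in>R. red u \<noteq> 0 \<and> u * x = lam ^ k * v)"

lemma lam_dvd_le: "lam_dvd k x \<Longrightarrow> i \<le> k \<Longrightarrow> lam_dvd i x"
  unfolding lam_dvd_def by (metis R_mult R_power lam_R le_add_diff_inverse mult.assoc power_add)

lemma lam_dvd_mult: "lam_dvd i x \<Longrightarrow> lam_dvd k y \<Longrightarrow> lam_dvd (i + k) (x * y)"
proof -
  assume "lam_dvd i x" "lam_dvd k y"
  then obtain u v u' v' where *: "u \<in> R" "v \<in> R" "red u \<noteq> 0" "u * x = lam ^ i * v"
    "u' \<in> R" "v' \<in> R" "red u' \<noteq> 0" "u' * y = lam ^ k * v'" unfolding lam_dvd_def by blast
  have "(u * u') * (x * y) = (u * x) * (u' * y)" by (simp add: mult_ac)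
  also have "\<dots> = lam ^ (i + k) * (v * v')" by (simp add: * power_add mult_ac)
  finally show ?thesis unfolding lam_dvd_def using *
    by (intro bexI[of _ "u * u'"] bexI[of _ "v * v'"]) (auto simp: red_mult)
qed

lemma lam_dvd_R: "x \<in> R \<Longrightarrow> lam_dvd 0 x"
  unfolding lam_dvd_def by (intro bexI[of _ 1] bexI[of _ x]) auto

lemma lam_dvd_add: "lam_dvd k x \<Longrightarrow> lam_dvd k y \<Longrightarrow> lam_dvd k (x + y)"
proof -
  assume "lam_dvd k x" "lam_dvd k y"
  then obtain u v u' v' where *: "u \<in> R" "v \<in> R" "red u \<noteq> 0" "u * x = lam ^ k * v"
    "u' \<in> R" "v' \<in> R" "red u' \<noteq> 0" "u' * y = lam ^ k * v'" unfolding lam_dvd_def by blast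
  have "(u * u') * (x + y) = (u * x) * u' + (u' * y) * u" by (simp add: algebra_simps)
  also have "\<dots> = lam ^ k * (v * u' + v' * u)" by (simp add: * algebra_simps)
  finally show ?thesis unfolding lam_dvd_def using *
    by (intro bexI[of _ "u * u'"] bexI[of _ "v * u' + v' * u"]) (auto simp: red_mult)
qed

lemma lam_dvd_0: "lam_dvd k 0"
  unfolding lam_dvd_def by (intro bexI[of _ 1] bexI[of _ 0]) auto

lemma lam_dvd_sum: "(\<And>i. i \<in> A \<Longrightarrow> lam_dvd k (f i)) \<Longrightarrow> lam_dvd k (sum f A)"
  by (induction A rule: infinite_finite_induct) (auto intro: lam_dvd_add lam_dvd_0)

lemma lam_dvd_q: "lam_dvd (2 * n) (of_nat q)"
proof -
  have "(- w) ^ n * of_nat q = lam ^ (2 * n) * 1" unfolding lam_even_power by (simp add: q)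
  thus ?thesis unfolding lam_dvd_def
    by (intro bexI[of _ "(- w) ^ n"] bexI[of _ 1] conjI)
      (simp_all add: red_power red_uminus R_power R_uminus)
qed

text \<open>The lower bound for \<open>gauss_sum j\<close> follows from the upper bound for \<open>gauss_sum (q - 1 - j)\<close>,
  since the product of the two is \<open>q\<close> up to a unit and the two digit sums add up to \<open>2 * n\<close>.\<close>

lemma lam_dvd_gauss_sum:
  assumes "0 < j" "j < q - 1"
  shows "lam_dvd (digit_sum j) (gauss_sum j)"
proof -
  define i where "i = q - 1 - j"
  have i: "0 < i" "i < q - 1" "i + j = q - 1" using assms by (auto simp: i_def)
  have s: "digit_sum i + digit_sum j = 2 * n"
    using digit_sum_complement[of j n] assms by (simp add: i_def q)
  obtain u v where uv: "u \<in> R" "v \<in> R" "red u \<noteq> 0" "gauss_sum i * v = lam ^ digit_sum i * u"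
    using gauss_sum_dvd_lam_power[OF i(1,2)] by blast
  have "\<not> (q - 1) dvd i" using i by (simp add: nat_dvd_not_less)
  hence refl: "gauss_sum j * gauss_sum i = \<chi> (- 1) ^ i * of_nat q"
    by (rule gauss_sum_reflection) (simp add: i(3) add.commute)
  have "lam ^ digit_sum i * (((- w) ^ n * u) * gauss_sum j) =
      (- w) ^ n * (gauss_sum i * v) * gauss_sum j"
    unfolding uv(4) by (simp only: mult_ac)
  also have "\<dots> = (- w) ^ n * v * (gauss_sum j * gauss_sum i)" by (simp add: mult_ac)
  also have "\<dots> = lam ^ (digit_sum i + digit_sum j) * (\<chi> (- 1) ^ i * v)"
    unfolding refl s lam_even_power by (simp add: q mult_ac)
  finally have "((- w) ^ n * u) * gauss_sum j = lam ^ digit_sum j * (\<chi> (- 1) ^ i * v)"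
    by (simp add: power_add mult.assoc)
  thus ?thesis unfolding lam_dvd_def using uv
    by (intro bexI[of _ "(- w) ^ n * u"] bexI[of _ "\<chi> (- 1) ^ i * v"])
      (auto simp: red_mult red_power red_uminus R_power R_uminus)
qed

text \<open>Since \<open>lam ^ 2\<close> is \<open>3\<close> up to a unit, the equation reads
  \<open>u * k = 3 ^ m * v\<close>. Applying \<open>red\<close>, where
  \<open>red u \<noteq> 0\<close>, shows that 3 divides \<open>k\<close>; cancel it and
  repeat.\<close>

lemma lam_dvd_of_int:
  assumes "lam_dvd (2 * m) (of_int k)"
  shows "3 ^ m dvd k"
proof -
  obtain u v where uv: "u \<in> R" "v \<in> R" "red u \<noteq> 0" "u * of_int k = lam ^ (2 * m) * v"
    using assms unfolding lam_dvd_def by blast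
  have "3 ^ m dvd k" if "v \<in> R" "u * of_int k = 3 ^ m * v" for v k using that
  proof (induction m arbitrary: k)
    case (Suc m)
    have "red u * of_int k = red (u * of_int k)" using uv by (simp add: red_mult)
    also have "\<dots> = red 3 * red (3 ^ m * v)"
      unfolding Suc.prems using Suc.prems by (subst red_mult[symmetric]) (auto simp: mult.assoc)
    also have "red 3 = 0" using red_of_nat[of 3] three_eq_0 by simp
    finally have "of_int k = (0 :: 'a)" using uv by simp
    hence "3 dvd k" by (simp add: of_int_eq_0_iff_char_dvd char_3)
    then obtain k' where k': "k = 3 * k'" by auto
    hence "u * of_int k' = 3 ^ m * v" using Suc.prems by simp
    thus ?case using Suc.IH[OF Suc.prems(1)] k' by simp
  qed simp
  moreover have "u * of_int k = 3 ^ m * ((- w) ^ m * v)"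
    by (simp only: uv(4) lam_even_power mult.assoc)
  moreover have "(- w) ^ m * v \<in> R" using uv by auto
  ultimately show ?thesis by blast
qed

section \<open>Weil sums as sums of products of two Gauss sums\<close>

lemma psi_fourier:
  assumes "y \<noteq> 0"
  shows "of_nat (q - 1) * \<psi> y = (\<Sum>j<q - 1. gauss_sum j * \<chi> y ^ j)"
proof -
  have "(\<Sum>j<q - 1. gauss_sum j * \<chi> y ^ j) = (\<Sum>x\<in>U. \<psi> x * (\<Sum>j<q - 1. \<chi> (y / x) ^ j))"
    unfolding gauss_sum_def sum_distrib_right sum_distrib_left
    by (subst sum.swap) (simp add: chi_mult power_mult_distrib divide_inverse mult_ac)
  also have "\<dots> = (\<Sum>x\<in>U. if x = y then of_nat (q - 1) * \<psi> y else 0)"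
  proof (rule sum.cong[OF refl])
    fix x assume x: "x \<in> U"
    have "(\<Sum>j<q - 1. \<chi> (y / x) ^ j) = 0" if "x \<noteq> y"
    proof -
      have "y / x \<noteq> 0" using x assms by simp
      hence "\<chi> (y / x) ^ (q - 1) = 1" by (rule chi_power_q_1)
      hence "(\<chi> (y / x) - 1) * (\<Sum>j<q - 1. \<chi> (y / x) ^ j) = 0"
        by (simp only: power_diff_1_eq[symmetric] diff_self)
      moreover have "\<chi> (y / x) \<noteq> 1"
      proof
        assume "\<chi> (y / x) = 1"
        hence "red (\<chi> (y / x)) = red 1" by (rule arg_cong)
        hence "y / x = 1" by simp
        thus False using x that by simp
      qed
      ultimately show ?thesis by simp
    qed
    thus "\<psi> x * (\<Sum>j<q - 1. \<chi> (y / x) ^ j) = (if x = y then of_nat (q - 1) * \<psi> y else 0)"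
      using x by auto
  qed
  also have "\<dots> = of_nat (q - 1) * \<psi> y" using assms by simp
  finally show ?thesis ..
qed

text \<open>Expand \<open>\<psi> (x ^ d)\<close> by \<open>psi_fourier\<close> and sum over
  \<open>x\<close>. The factor \<open>q - 2\<close> stands for \<open>- 1\<close> modulo
  \<open>q - 1\<close>, which keeps the index a natural number. The point \<open>x = 0\<close> gives
  \<open>q - 1\<close> and the index \<open>j = 0\<close> gives \<open>1\<close>, together the
  isolated \<open>q\<close>.\<close>

lemma weil_sum_gauss_sums:
  fixes a :: 'a
  assumes "a \<noteq> 0" "d > 0"
  shows "of_nat (q - 1) * weil_sum d a = of_nat q +
    (\<Sum>j\<in>{1..<q - 1}. gauss_sum j * \<chi> (- a) ^ ((q - 2) * (d * j)) * gauss_sum ((q - 2) * (d * j)))"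
    (is "_ = of_nat q + (\<Sum>j\<in>_. ?f j)")
proof -
  have "weil_sum d a = 1 + (\<Sum>x\<in>U. \<psi> (x ^ d) * \<psi> (- a * x))"
    unfolding weil_sum_def using assms
    by (subst sum.remove[of UNIV 0]) (auto simp: psi_add[symmetric] power_0_left)
  hence "of_nat (q - 1) * weil_sum d a =
      of_nat (q - 1) + (\<Sum>x\<in>U. (of_nat (q - 1) * \<psi> (x ^ d)) * \<psi> (- a * x))"
    by (simp only: distrib_left sum_distrib_left mult_1_right mult.assoc)
  also have "(\<Sum>x\<in>U. (of_nat (q - 1) * \<psi> (x ^ d)) * \<psi> (- a * x)) =
      (\<Sum>x\<in>U. (\<Sum>j<q - 1. gauss_sum j * \<chi> (x ^ d) ^ j) * \<psi> (- a * x))"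
    by (intro sum.cong refl) (subst psi_fourier, auto)
  also have "\<dots> = (\<Sum>j<q - 1. gauss_sum j * (\<Sum>x\<in>U. \<chi> (x ^ d) ^ j * \<psi> (- a * x)))"
    unfolding sum_distrib_right sum_distrib_left by (subst sum.swap) (simp add: mult_ac)
  also have "\<dots> = (\<Sum>j<q - 1. ?f j)"
  proof (rule sum.cong[OF refl])
    fix j
    have *: "\<chi> (x ^ d) ^ j = \<chi> (inverse x) ^ ((q - 2) * (d * j))" if "x \<noteq> 0" for x
    proof -
      have "\<chi> (inverse x) ^ ((q - 1) * (d * j)) = 1"
        using chi_power_q_1[of "inverse x"] that by (simp only: power_mult inverse_nonzero_iff_nonzero) simp
      moreover have "(q - 1) * (d * j) = (q - 2) * (d * j) + d * j"
        using q_gt by (simp add: algebra_simps diff_mult_distrib)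
      ultimately have "\<chi> (inverse x) ^ ((q - 2) * (d * j)) * \<chi> (inverse x) ^ (d * j) = 1"
        by (simp only: power_add)
      moreover have "\<chi> (inverse x) ^ (d * j) = inverse (\<chi> x ^ (d * j))"
        by (simp only: chi_inverse power_inverse)
      moreover have "A = B" if "A * inverse B = 1" "B \<noteq> 0" for A B :: complex
        using that by (simp add: field_simps)
      ultimately have "\<chi> (inverse x) ^ ((q - 2) * (d * j)) = \<chi> x ^ (d * j)"
        using that by (metis chi_eq_0_iff power_not_zero)
      thus ?thesis by (simp add: chi_power power_mult)
    qed
    have "(\<Sum>x\<in>U. \<chi> (x ^ d) ^ j * \<psi> (- a * x)) =
        (\<Sum>x\<in>U. \<chi> (inverse x) ^ ((q - 2) * (d * j)) * \<psi> (- a * x))"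
      by (intro sum.cong) (auto simp: *)
    also have "\<dots> = \<chi> (- a) ^ ((q - 2) * (d * j)) * gauss_sum ((q - 2) * (d * j))"
      using assms by (subst gauss_sum_twist) auto
    finally show "gauss_sum j * (\<Sum>x\<in>U. \<chi> (x ^ d) ^ j * \<psi> (- a * x)) = ?f j" by simp
  qed
  also have "\<dots> = ?f 0 + (\<Sum>j\<in>{1..<q - 1}. ?f j)"
  proof -
    have "{..<q - 1} = insert 0 {1..<q - 1}" using q_gt by auto
    thus ?thesis by simp
  qed
  also have "?f 0 = 1" by (simp add: gauss_sum_0)
  finally show ?thesis using q_gt by (simp add: of_nat_diff)
qed

text \<open>Each product of Gauss sums has indices \<open>j\<close> and \<open>k\<close>, the
  residue of \<open>- d * j\<close>; coprimality keeps \<open>k\<close> nonzero, so both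
  Stickelberger bounds apply. The isolated \<open>q\<close> is divisible by
  \<open>lam ^ (2 * n)\<close>, and the factor \<open>q - 1\<close> is harmless because its residue
  is \<open>- 1\<close>.\<close>

lemma lam_dvd_weil_sum:
  fixes a :: 'a
  assumes "a \<noteq> 0" "d > 0" "coprime d (q - 1)" "m \<le> 2 * n"
    and digits: "\<And>j k. \<lbrakk>0 < j; j < q - 1; 0 < k; k < q - 1; (q - 1) dvd d * j + k\<rbrakk> \<Longrightarrow>
      m \<le> digit_sum j + digit_sum k"
  shows "lam_dvd m (weil_sum d a)"
proof -
  have "lam_dvd m (gauss_sum j * \<chi> (- a) ^ ((q - 2) * (d * j)) * gauss_sum ((q - 2) * (d * j)))"
    if j: "j \<in> {1..<q - 1}" for j
  proof -
    define k where "k = ((q - 2) * (d * j)) mod (q - 1)"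
    have k1: "k < q - 1" using q_gt by (simp add: k_def)
    have "d * j + (q - 2) * (d * j) = (q - 1) * (d * j)" using q_gt
      by (simp add: algebra_simps diff_mult_distrib)
    hence "(q - 1) dvd d * j + (q - 2) * (d * j)" by simp
    hence dvd: "(q - 1) dvd d * j + k" unfolding k_def
      by (simp only: dvd_eq_mod_eq_0 mod_add_right_eq)
    have "k \<noteq> 0"
    proof
      assume "k = 0"
      hence "(q - 1) dvd j" using dvd assms(3) by (simp add: coprime_commute coprime_dvd_mult_right_iff)
      thus False using j by (auto dest: dvd_imp_le)
    qed
    hence k: "0 < k" "k < q - 1" using k1 by auto
    have "gauss_sum ((q - 2) * (d * j)) = gauss_sum k"
      by (rule gauss_sum_cong) (simp add: k_def)
    moreover have "lam_dvd (digit_sum j + 0 + digit_sum k)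
        (gauss_sum j * \<chi> (- a) ^ ((q - 2) * (d * j)) * gauss_sum k)"
      using j k by (intro lam_dvd_mult lam_dvd_gauss_sum lam_dvd_R R_power chi_R) auto
    ultimately show ?thesis using digits[of j k] j k dvd by (auto elim!: lam_dvd_le)
  qed
  hence "lam_dvd m (of_nat (q - 1) * weil_sum d a)"
    unfolding weil_sum_gauss_sums[OF assms(1,2)]
    by (intro lam_dvd_add lam_dvd_sum lam_dvd_le[OF lam_dvd_q assms(4)])
  then obtain u v where uv: "u \<in> R" "v \<in> R" "red u \<noteq> 0"
    "u * (of_nat (q - 1) * weil_sum d a) = lam ^ m * v" unfolding lam_dvd_def by blast
  moreover have "red (u * of_nat (q - 1)) \<noteq> 0"
    using uv by (simp only: red_mult R_of_nat red_of_nat of_nat_q_1) simp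
  moreover have "(u * of_nat (q - 1)) * weil_sum d a = lam ^ m * v" using uv(4) by (simp only: mult.assoc)
  ultimately show ?thesis unfolding lam_dvd_def by (blast intro: R_mult R_of_nat)
qed

end

section \<open>Digit sums and carries\<close>

lemma digits_expansion:
  fixes j :: nat
  assumes "j < 3 ^ n"
  shows "j = (\<Sum>i<n. (j div 3 ^ i) mod 3 * 3 ^ i)" "digit_sum j = (\<Sum>i<n. (j div 3 ^ i) mod 3)"
proof -
  have "j = (\<Sum>i<n. (j div 3 ^ i) mod 3 * 3 ^ i) \<and> digit_sum j = (\<Sum>i<n. (j div 3 ^ i) mod 3)"
    using assms
  proof (induction n arbitrary: j)
    case (Suc n)
    have div: "j div 3 ^ Suc i = (j div 3) div 3 ^ i" for i by (simp add: div_mult2_eq)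
    have IH: "j div 3 = (\<Sum>i<n. (j div 3 div 3 ^ i) mod 3 * 3 ^ i)"
      "digit_sum (j div 3) = (\<Sum>i<n. (j div 3 div 3 ^ i) mod 3)"
      using Suc.IH[of "j div 3"] Suc.prems by auto
    have "(\<Sum>i<Suc n. (j div 3 ^ i) mod 3 * 3 ^ i) =
        j mod 3 + 3 * (\<Sum>i<n. (j div 3 div 3 ^ i) mod 3 * 3 ^ i)"
      by (subst sum.lessThan_Suc_shift) (simp only: div, simp add: sum_distrib_left mult_ac)
    also have "\<dots> = j" using IH(1) by simp
    finally have "(\<Sum>i<Suc n. (j div 3 ^ i) mod 3 * 3 ^ i) = j" .
    moreover have "(\<Sum>i<Suc n. (j div 3 ^ i) mod 3) = j mod 3 + digit_sum (j div 3)"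
      by (subst sum.lessThan_Suc_shift) (simp only: div IH(2), simp)
    ultimately show ?case using digit_sum_rec[of j] by simp
  qed simp
  thus "j = (\<Sum>i<n. (j div 3 ^ i) mod 3 * 3 ^ i)" "digit_sum j = (\<Sum>i<n. (j div 3 ^ i) mod 3)"
    by auto
qed

lemma sum_periodic_coprime:
  fixes f :: "nat \<Rightarrow> 'b::comm_monoid_add"
  assumes per: "\<And>i. f (i mod n) = f i" and "coprime r n" "n > 0"
  shows "(\<Sum>m<n. f (r * m + b)) = (\<Sum>i<n. f i)"
proof -
  have "inj_on (\<lambda>m. (r * m + b) mod n) {..<n}"
  proof (rule inj_onI)
    fix x y assume xy: "x \<in> {..<n}" "y \<in> {..<n}" "(r * x + b) mod n = (r * y + b) mod n"
    hence "[r * x = r * y] (mod n)" by (simp add: cong_def[symmetric] cong_add_rcancel_nat)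
    hence "[x = y] (mod n)" using assms(2) by (simp add: cong_mult_lcancel_nat)
    thus "x = y" using xy by (simp add: cong_def)
  qed
  moreover have "(\<lambda>m. (r * m + b) mod n) ` {..<n} \<subseteq> {..<n}" using assms(3) by auto
  ultimately have "bij_betw (\<lambda>m. (r * m + b) mod n) {..<n} {..<n}"
    by (simp add: bij_betw_def endo_inj_surj)
  hence "(\<Sum>m<n. f ((r * m + b) mod n)) = (\<Sum>i<n. f i)" by (rule sum.reindex_bij_betw)
  thus ?thesis by (simp add: per)
qed

text \<open>The potential of a state of the carry graph, found by a shortest path computation. In the state
  \<open>(e, c\<^sub>1, c\<^sub>2, c\<^sub>3)\<close> the digit \<open>x\<close> produces the carry \<open>c\<^sub>4 \<ge> (e + 2 * x) div 3\<close> four places later.\<close>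

definition carry_potential :: "nat \<Rightarrow> nat \<Rightarrow> nat \<Rightarrow> nat \<Rightarrow> nat" where
  "carry_potential e c\<^sub>1 c\<^sub>2 c\<^sub>3 =
  [
   [[[0, 0, 0], [1, 1, 1], [1, 1, 1]],
    [[0, 0, 1], [1, 2, 2], [1, 2, 2]],
    [[1, 2, 2], [2, 2, 2], [2, 2, 2]]],
   [[[1, 1, 2], [1, 2, 2], [1, 2, 2]],
    [[2, 2, 2], [2, 2, 2], [2, 2, 2]],
    [[2, 2, 2], [2, 2, 2], [2, 2, 2]]],
   [[[1, 2, 2], [1, 2, 2], [2, 3, 3]],
    [[2, 2, 2], [3, 3, 3], [3, 3, 3]],
    [[2, 2, 3], [3, 3, 3], [3, 3, 3]]],
   [[[2, 3, 3], [3, 3, 3], [3, 3, 3]],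
    [[3, 3, 3], [3, 3, 3], [3, 3, 3]],
    [[3, 3, 3], [3, 3, 3], [3, 3, 3]]],
   [[[3, 3, 3], [3, 3, 3], [3, 3, 3]],
    [[3, 3, 3], [3, 3, 3], [3, 3, 3]],
    [[3, 3, 3], [3, 3, 3], [3, 3, 3]]]] ! e ! c\<^sub>1 ! c\<^sub>2 ! c\<^sub>3"

text \<open>Along each edge the gain \<open>2 * x - 2 * c\<^sub>4 - 1\<close> is at most the
  increase of the potential, so its total around a closed walk is not positive. Carries above the
  least one are included because the carries are only known to satisfy an inequality.\<close>

lemma carry_potential_table:
  "\<forall>e\<in>set [0..<5]. \<forall>c\<^sub>1\<in>set [0..<3]. \<forall>c\<^sub>2\<in>set [0..<3]. \<forall>c\<^sub>3\<in>set [0..<3]. \<forall>x\<in>set [0..<3].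
    \<forall>c\<^sub>4\<in>set [(e + 2 * x) div 3..<3].
    carry_potential e c\<^sub>1 c\<^sub>2 c\<^sub>3 + 2 * x \<le> carry_potential (c\<^sub>1 + x) c\<^sub>2 c\<^sub>3 c\<^sub>4 + 2 * c\<^sub>4 + 1"
  by code_simp

lemma carry_potential_step:
  assumes "e \<le> 4" "c\<^sub>1 \<le> 2" "c\<^sub>2 \<le> 2" "c\<^sub>3 \<le> 2" "x \<le> 2" "(e + 2 * x) div 3 \<le> c\<^sub>4" "c\<^sub>4 \<le> 2"
  shows "carry_potential e c\<^sub>1 c\<^sub>2 c\<^sub>3 + 2 * x \<le> carry_potential (c\<^sub>1 + x) c\<^sub>2 c\<^sub>3 c\<^sub>4 + 2 * c\<^sub>4 + 1"
proof -
  have "e \<in> set [0..<5]" "c\<^sub>1 \<in> set [0..<3]" "c\<^sub>2 \<in> set [0..<3]" "c\<^sub>3 \<in> set [0..<3]" "x \<in> set [0..<3]"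
    "c\<^sub>4 \<in> set [(e + 2 * x) div 3..<3]"
    using assms by auto
  thus ?thesis using carry_potential_table by blast
qed

text \<open>With \<open>4 * r = 1\<close> modulo \<open>n\<close>, listing the positions as \<open>0, r, 2 * r, \<dots>\<close> turns the shift by \<open>r\<close>
  into a shift by one place and the carry into a shift by four places, whatever \<open>n\<close> is.\<close>

lemma carry_sum_bound:
  fixes x C :: "nat \<Rightarrow> nat"
  assumes "[4 * r = 1] (mod n)" "n > 0" "n dvd r + s"
    and x: "\<And>i. x (i mod n) = x i" "\<And>i. x i \<le> 2" and C: "\<And>i. C (i mod n) = C i"
    and step: "\<And>i. C i + x (i + s) + 2 * x i \<le> 3 * C (i + 1) + 2"
  shows "2 * (\<Sum>i<n. x i) \<le> 2 * (\<Sum>i<n. C i) + n"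
proof -
  have "coprime (4 * r) n" using cong_imp_coprime[OF cong_sym[OF assms(1)]] by simp
  hence cop: "coprime r n" by simp
  \<comment> \<open>Capping at 2 makes the state space finite. The recursion survives, because carry
    and digits at most 2 give a new carry of at most \<open>8 div 3 = 2\<close>.\<close>
  define D where "D i = min (C i) 2" for i
  have D: "D (i mod n) = D i" "D i \<le> 2" "D i \<le> C i" for i by (auto simp: D_def C)
  have D_step: "(D i + x (i + s) + 2 * x i) div 3 \<le> D (i + 1)" for i
    using step[of i] x(2)[of i] x(2)[of "i + s"] unfolding D_def by linarith
  define X E where "X m = x (r * m)" and "E m = D (r * m)" for m
  have XE: "X m \<le> 2" "E m \<le> 2" for m by (auto simp: X_def E_def x D)
  have X_per: "x i = x k" if "[i = k] (mod n)" for i k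
    using that x(1)[of i] x(1)[of k] by (simp add: cong_def)
  have D_per: "D i = D k" if "[i = k] (mod n)" for i k
    using that D(1)[of i] D(1)[of k] by (simp add: cong_def)
  have E_step: "(E (m + 1) + X m + 2 * X (m + 1)) div 3 \<le> E (m + 5)" for m
  proof -
    \<comment> \<open>As \<open>s\<close> is \<open>- r\<close> modulo \<open>n\<close>, the digit
      displaced by \<open>s\<close> is the one listed just before.\<close>
    have "[r * (m + 1) + s = r * m + (r + s)] (mod n)" by (simp add: algebra_simps)
    also have "[r * m + (r + s) = r * m + 0] (mod n)"
      using assms(3) by (intro cong_add cong_refl) (simp add: cong_0_iff)
    finally have x: "x (r * (m + 1) + s) = X m" unfolding X_def by (intro X_per) simp
    have "[r * (m + 5) = r * (m + 1) + 4 * r] (mod n)" by (simp add: algebra_simps)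
    hence "[r * (m + 5) = r * (m + 1) + 1] (mod n)"
      by (rule cong_trans) (intro cong_add cong_refl assms(1))
    hence E: "E (m + 5) = D (r * (m + 1) + 1)" unfolding E_def by (rule D_per)
    show ?thesis using D_step[of "r * (m + 1)"] unfolding x E by (simp only: X_def E_def)
  qed
  \<comment> \<open>The first coordinate merges a carry with the preceding digit, since only their
    sum enters the next step.\<close>
  define P where "P m = carry_potential (E (m + 1) + X m) (E (m + 2)) (E (m + 3)) (E (m + 4))" for m
  have P_step: "P m + 2 * X (m + 1) \<le> P (m + 1) + 2 * E (m + 5) + 1" for m
  proof -
    have idx: "m + 1 + 1 = m + 2" "m + 1 + 2 = m + 3" "m + 1 + 3 = m + 4" "m + 1 + 4 = m + 5" by simp_all
    have "E (m + 1) + X m \<le> 4" using XE(1)[of m] XE(2)[of "m + 1"] by linarith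
    thus ?thesis unfolding P_def idx
      by (rule carry_potential_step[OF _ XE(2) XE(2) XE(2) XE(1) E_step[of m] XE(2)])
  qed
  have "P 0 + (\<Sum>m<k. 2 * X (m + 1)) \<le> P k + (\<Sum>m<k. 2 * E (m + 5) + 1)" for k
  proof (induction k)
    case (Suc k)
    thus ?case using P_step[of k] by simp
  qed simp
  from this[of n] have "P 0 + (\<Sum>m<n. 2 * X (m + 1)) \<le> P n + (\<Sum>m<n. 2 * E (m + 5) + 1)" .
  moreover have "P n = P 0"
  proof -
    have "[r * (n + i) = r * i] (mod n)" for i by (simp add: cong_def algebra_simps)
    hence XE_per: "X (n + i) = X i" "E (n + i) = E i" for i
      unfolding X_def E_def by (blast intro: X_per D_per)+
    have "X n = X 0" using XE_per(1)[of 0] by simp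
    thus ?thesis by (simp only: P_def XE_per(2) add_0)
  qed
  moreover have "(\<Sum>m<n. X (m + 1)) = (\<Sum>i<n. x i)" "(\<Sum>m<n. E (m + 5)) = (\<Sum>i<n. D i)"
    unfolding X_def E_def distrib_left
    using sum_periodic_coprime[of x n r] sum_periodic_coprime[of D n r] x D cop assms(2) by simp_all
  moreover have "(\<Sum>i<n. D i) \<le> (\<Sum>i<n. C i)" by (intro sum_mono D)
  moreover have "(\<Sum>m<n. 2 * X (m + 1)) = 2 * (\<Sum>m<n. X (m + 1))"
    by (simp only: sum_distrib_left)
  moreover have "(\<Sum>m<n. 2 * E (m + 5) + 1) = 2 * (\<Sum>m<n. E (m + 5)) + n"
    by (simp only: sum_distrib_left sum.distrib) simp
  ultimately show ?thesis by linarith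
qed

text \<open>Every rotation of the digit words turns \<open>(3 ^ r + 2) * j + k\<close> into a
  multiple \<open>T i\<close> of \<open>3 ^ n - 1\<close>, and the quotients \<open>C i\<close> are
  the carries of the cyclic addition. Summing their recursion gives
  \<open>2 * \<Sum>C = 3 * \<Sum>x + \<Sum>y\<close>. Inserting \<open>carry_sum_bound\<close> for
  the carries lowered by one leaves \<open>n \<le> \<Sum>x + \<Sum>y\<close>; the identity also
  makes the right side even, so it differs from the odd \<open>n\<close>.\<close>

lemma digit_sum_bound:
  fixes j k n r :: nat
  assumes "odd n" "n > 1" and r: "[4 * r = 1] (mod n)"
    and j: "0 < j" "j < 3 ^ n - 1" and k: "k < 3 ^ n - 1"
    and dvd: "(3 ^ n - 1) dvd (3 ^ r + 2) * j + k"
  shows "n + 1 \<le> digit_sum j + digit_sum k"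
proof -
  define M :: nat where "M = 3 ^ n - 1"
  have M: "3 ^ n = M + 1" "M > 0" using j by (auto simp: M_def)
  \<comment> \<open>A natural number congruent to \<open>- r\<close> modulo \<open>n\<close>:
    reading the digits from place \<open>s\<close> multiplies by \<open>3 ^ r\<close> modulo
    \<open>M\<close>.\<close>
  define s where "s = (n - 1) * r"
  have s: "r + s = n * r" using assms(2) by (simp add: s_def diff_mult_distrib)
  define x y :: "nat \<Rightarrow> nat" where "x i = (j div 3 ^ (i mod n)) mod 3" and "y i = (k div 3 ^ (i mod n)) mod 3" for i
  have per: "x (i mod n) = x i" "y (i mod n) = y i" "x (i + n) = x i" "y (i + n) = y i" for i
    by (simp_all add: x_def y_def)
  have le: "x i \<le> 2" "y i \<le> 2" for i by (simp_all add: x_def y_def)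
  \<comment> \<open>The number whose digits are \<open>f\<close> read cyclically from place
    \<open>i\<close>. Moving on by one place divides it by 3 modulo \<open>M\<close>.\<close>
  define V :: "(nat \<Rightarrow> nat) \<Rightarrow> nat \<Rightarrow> nat" where "V = (\<lambda>f i. \<Sum>t<n. f (i + t) * 3 ^ t)"
  have V_step: "3 * V f (i + 1) = V f i + M * f i" if "\<And>i. f (i + n) = f i" for f i
  proof -
    obtain m where m: "n = Suc m" using assms(2) by (cases n) auto
    have "3 * V f (i + 1) = (\<Sum>t<m. f (i + Suc t) * 3 ^ Suc t) + f (i + n) * 3 ^ n"
      by (simp add: V_def m sum_distrib_left algebra_simps)
    also have "\<dots> = (\<Sum>t<Suc m. f (i + t) * 3 ^ t) + M * f i"
      by (subst sum.lessThan_Suc_shift) (simp add: that M(1) algebra_simps)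
    finally show ?thesis by (simp add: V_def m)
  qed
  have V_power: "[3 ^ i * V f i = V f 0] (mod M)" if "\<And>i. f (i + n) = f i" for f i
  proof (induction i)
    case (Suc i)
    have "3 * V f (Suc i) = V f i + M * f i" using V_step[of f i] that by simp
    hence "3 ^ Suc i * V f (Suc i) = 3 ^ i * (V f i + M * f i)" by (simp add: mult.assoc mult.commute[of 3])
    also have "[\<dots> = 3 ^ i * V f i] (mod M)" by (simp add: cong_def algebra_simps)
    finally show ?case using Suc cong_trans by blast
  qed simp
  have V_0: "V x 0 = j" "V y 0 = k"
    using digits_expansion(1)[of j n] digits_expansion(1)[of k n] j k
    by (simp_all add: V_def x_def y_def)
  define T where "T i = V x (i + s) + 2 * V x i + V y i" for i
  define Z where "Z i = x (i + s) + 2 * x i + y i" for i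
  have T_step: "3 * T (i + 1) = T i + M * Z i" for i
    using V_step[of x "i + s"] V_step[of x i] V_step[of y i] per
    by (simp add: T_def Z_def algebra_simps)
  have "[3 ^ n = 1] (mod M)" unfolding M(1) cong_def by (rule mod_add_self1)
  hence q_r: "[3 ^ (n * r) = 1] (mod M)" using cong_pow[of "3 ^ n" 1 M r] by (simp add: power_mult)
  have "[V x s = 3 ^ (n * r) * V x s] (mod M)"
    using cong_mult[OF cong_sym[OF q_r] cong_refl[of "V x s"]] by simp
  also have "3 ^ (n * r) * V x s = 3 ^ r * (3 ^ s * V x s)" by (simp add: power_add flip: s)
  also have "[\<dots> = 3 ^ r * j] (mod M)" using V_power[of x s] per V_0 by (intro cong_mult cong_refl) simp
  finally have "[T 0 = 3 ^ r * j + 2 * j + k] (mod M)"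
    unfolding T_def using V_0 by (intro cong_add cong_refl cong_mult) simp_all
  moreover have "M dvd 3 ^ r * j + 2 * j + k" using dvd unfolding M_def by (simp only: distrib_right)
  ultimately have T0: "M dvd T 0" by (simp only: cong_dvd_iff)
  have "coprime M 3"
  proof -
    have "coprime M (M + 1)" by simp
    hence "coprime M (3 ^ n)" by (simp only: M)
    thus ?thesis using assms(2) by (simp add: coprime_power_right_iff)
  qed
  have T_dvd: "M dvd T i" for i
  proof (induction i)
    case (Suc i)
    hence "M dvd 3 * T (Suc i)" using T_step[of i] by simp
    thus ?case using \<open>coprime M 3\<close> by (simp add: coprime_dvd_mult_right_iff)
  qed (rule T0)
  have T_pos: "T i > 0" for i
  proof (induction i)
    case 0
    show ?case using V_0 j by (simp add: T_def)
  next
    case (Suc i)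
    thus ?case using T_step[of i] by (cases "T (Suc i)") auto
  qed
  define C where "C i = T i div M" for i
  have C_T: "T i = M * C i" for i using T_dvd[of i] by (simp add: C_def)
  \<comment> \<open>Positivity, which rests on \<open>j > 0\<close>, makes the truncated subtraction
    \<open>C i - 1\<close> below exact.\<close>
  have C_pos: "C i > 0" for i using T_pos[of i] C_T[of i] by (cases "C i") auto
  have C_step: "3 * C (i + 1) = C i + Z i" for i
  proof -
    have "M * (3 * C (i + 1)) = M * (C i + Z i)"
      using T_step[of i] unfolding C_T by (simp add: algebra_simps)
    thus ?thesis using M by simp
  qed
  have mod_idx: "f ((i mod n) + t) = f (i + t)" if "\<And>i. f (i mod n) = f i" for f :: "nat \<Rightarrow> nat" and i t
    using that[of "i mod n + t"] that[of "i + t"] by (simp add: mod_add_left_eq)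
  have V_mod: "V f (i mod n) = V f i" if "\<And>i. f (i mod n) = f i" for f i
    unfolding V_def using mod_idx[of f] that by simp
  have "V x (i mod n + s) = V x (i + s)" for i
    using V_mod[of x "i mod n + s"] V_mod[of x "i + s"] per by (simp add: mod_add_left_eq)
  hence C_per: "C (i mod n) = C i" for i
    using per by (simp add: C_def T_def V_mod)
  have sums: "(\<Sum>i<n. f (i + b)) = (\<Sum>i<n. f i)" if "\<And>i. f (i mod n) = f i" for f :: "nat \<Rightarrow> nat" and b
    using sum_periodic_coprime[of f n 1 b] that assms(2) by simp
  have "3 * (\<Sum>i<n. C (i + 1)) = (\<Sum>i<n. C i) + (\<Sum>i<n. Z i)"
    unfolding sum_distrib_left C_step by (simp add: sum.distrib)
  hence "2 * (\<Sum>i<n. C i) = (\<Sum>i<n. Z i)" using sums[of C 1] C_per by simp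
  also have "\<dots> = 3 * (\<Sum>i<n. x i) + (\<Sum>i<n. y i)"
    using sums[of x s] per by (simp add: Z_def sum.distrib flip: sum_distrib_left)
  finally have sum_C: "2 * (\<Sum>i<n. C i) = 3 * (\<Sum>i<n. x i) + (\<Sum>i<n. y i)" .
  \<comment> \<open>Dropping the digit \<open>y i\<close> and lowering all carries by one turns the
    recursion into the inequality with slack 2.\<close>
  have "2 * (\<Sum>i<n. x i) \<le> 2 * (\<Sum>i<n. C i - 1) + n"
  proof (rule carry_sum_bound[where x = x and C = "\<lambda>i. C i - 1", OF r])
    fix i show "C i - 1 + x (i + s) + 2 * x i \<le> 3 * (C (i + 1) - 1) + 2"
      using C_step[of i] C_pos[of i] C_pos[of "i + 1"] unfolding Z_def by linarith
  qed (use assms(2) s C_per per le in auto)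
  moreover have "(\<Sum>i<n. C i - 1) + n = (\<Sum>i<n. C i)"
  proof -
    have "(\<Sum>i<n. C i - 1) + n = (\<Sum>i<n. C i - 1 + 1)" by (simp only: sum.distrib) simp
    also have "\<dots> = (\<Sum>i<n. C i)" using C_pos by (intro sum.cong) auto
    finally show ?thesis .
  qed
  ultimately have "n \<le> (\<Sum>i<n. x i) + (\<Sum>i<n. y i)" using sum_C by linarith
  moreover have "even (3 * (\<Sum>i<n. x i) + (\<Sum>i<n. y i))" unfolding sum_C[symmetric] by simp
  hence "even ((\<Sum>i<n. x i) + (\<Sum>i<n. y i))" by simp
  hence "(\<Sum>i<n. x i) + (\<Sum>i<n. y i) \<noteq> n" using assms(1) by metis
  moreover have "(\<Sum>i<n. x i) = digit_sum j" "(\<Sum>i<n. y i) = digit_sum k"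
    using digits_expansion(2)[of j n] digits_expansion(2)[of k n] j k by (simp_all add: x_def y_def)
  ultimately show ?thesis by linarith
qed

section \<open>The first two moments\<close>

text \<open>Modulo any divisor of \<open>3 ^ n - 1\<close> the fourth power of \<open>3 ^ r\<close>
  is \<open>3\<close>. If \<open>3 ^ r\<close> is \<open>1\<close> there, then the divisor divides
  \<open>3 - 1\<close>. If it is \<open>- 2\<close> modulo a prime, then the prime divides
  \<open>16 - 3 = 13\<close>; but powers of 3 modulo 13 are only 1, 3 and 9.\<close>

lemma exponent_gcds:
  fixes n r :: nat
  assumes "n > 1" and r: "[4 * r = 1] (mod n)"
  shows "coprime (3 ^ r + 2) (3 ^ n - 1 :: nat)" "gcd (3 ^ r - 1) (3 ^ n - 1 :: nat) dvd 2"
proof -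
  have r0: "r > 0"
  proof (rule ccontr)
    assume "\<not> r > 0"
    hence "[0 = 1] (mod n)" using r by simp
    thus False using assms(1) by (simp add: cong_def)
  qed
  have "n dvd 4 * r - 1" using r r0 cong_altdef_nat[of 1 "4 * r" n] by (simp add: cong_sym_eq)
  then obtain k where "4 * r - 1 = n * k" by auto
  hence k: "r * 4 = n * k + 1" using r0 by simp
  have four: "[(3 ^ r) ^ 4 = (3::nat)] (mod m)" if "m dvd 3 ^ n - 1" for m
  proof -
    have "[3 ^ n = (1::nat)] (mod m)"
      using that cong_altdef_nat[of "1::nat" "3 ^ n" m] by simp
    hence "[(3 ^ n) ^ k * 3 = 1 ^ k * (3::nat)] (mod m)" by (intro cong_mult cong_pow cong_refl)
    thus ?thesis by (simp add: k power_add mult.commute flip: power_mult)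
  qed
  show "gcd (3 ^ r - 1) (3 ^ n - 1 :: nat) dvd 2"
  proof -
    define m where "m = gcd (3 ^ r - 1) (3 ^ n - 1 :: nat)"
    have "[3 ^ r = (1::nat)] (mod m)"
      using cong_altdef_nat[of "1::nat" "3 ^ r" m] by (simp add: m_def)
    hence "[(3 ^ r) ^ 4 = (1::nat) ^ 4] (mod m)" by (rule cong_pow)
    hence "[(3 ^ r) ^ 4 = (1::nat)] (mod m)" by simp
    moreover have "[(3 ^ r) ^ 4 = (3::nat)] (mod m)" by (rule four) (simp add: m_def)
    ultimately have "[(3::nat) = 1] (mod m)" by (meson cong_sym cong_trans)
    hence "m dvd 2" using cong_altdef_nat[of "1::nat" 3 m] by simp
    thus ?thesis unfolding m_def .
  qed
  show "coprime (3 ^ r + 2) (3 ^ n - 1 :: nat)"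
  proof (rule ccontr)
    assume "\<not> ?thesis"
    hence "gcd (3 ^ r + 2) (3 ^ n - 1 :: nat) \<noteq> 1" unfolding coprime_iff_gcd_eq_1 .
    then obtain p :: nat where p1: "prime p" "p dvd gcd (3 ^ r + 2) (3 ^ n - 1)"
      using prime_factor_nat by blast
    have p: "prime p" "p dvd 3 ^ r + 2" "p dvd 3 ^ n - 1"
      by (rule p1(1), rule dvd_trans[OF p1(2) gcd_dvd1], rule dvd_trans[OF p1(2) gcd_dvd2])
    have "int p dvd int (3 ^ r + 2)" using p(2) by (simp only: int_dvd_int_iff)
    hence "[int (3 ^ r) = - 2] (mod int p)"
      by (simp add: cong_iff_dvd_diff add.commute)
    hence "[int (3 ^ r) ^ 4 = (- 2) ^ 4] (mod int p)" by (rule cong_pow)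
    moreover have "[int (3 ^ r) ^ 4 = 3] (mod int p)"
      using four[OF p(3), folded cong_int_iff] by (simp only: of_nat_power of_nat_numeral)
    ultimately have "[16 = 3] (mod int p)" by (simp add: cong_def)
    hence "int p dvd 13" by (simp add: cong_iff_dvd_diff)
    hence "p dvd 13" by (metis int_dvd_int_iff of_nat_numeral)
    moreover have "prime (13::nat)" by simp
    ultimately have "p = 13" using p(1) by (metis primes_dvd_imp_eq)
    have "[27 ^ (r div 3) * 3 ^ (r mod 3) = 1 ^ (r div 3) * (3::nat) ^ (r mod 3)] (mod 13)"
      by (intro cong_mult cong_pow cong_refl) (simp add: cong_def)
    moreover have "27 ^ (r div 3) * 3 ^ (r mod 3) = (3::nat) ^ (3 * (r div 3) + r mod 3)"
      by (simp only: power_add power_mult) simp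
    ultimately have "(3::nat) ^ r mod 13 = 3 ^ (r mod 3) mod 13" by (simp add: cong_def)
    moreover have "r mod 3 = 0 \<or> r mod 3 = 1 \<or> r mod 3 = 2" by linarith
    ultimately have "(3::nat) ^ r mod 13 \<in> {1, 3, 9}" by auto
    moreover have "(3 ^ r + 2) mod 13 = (0::nat)" using p(2) \<open>p = 13\<close> by simp
    hence "(3 ^ r mod 13 + 2) mod 13 = (0::nat)" by (simp only: mod_add_left_eq)
    ultimately show False by (auto dest: dvd_imp_le)
  qed
qed

locale weil_exponent = teichmueller +
  fixes r d :: nat
  assumes odd_n: "odd n" and r: "[4 * r = 1] (mod n)" and d: "d = 3 ^ r + 2"
begin

lemma coprime_d: "coprime d (q - 1)"
  using exponent_gcds(1)[OF n r] by (simp add: d q)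

lemma odd_d: "odd d" by (simp add: d)

abbreviation W :: "'a \<Rightarrow> complex" where "W \<equiv> weil_sum d"

lemma coprime_power_bij:
  assumes "coprime a (q - 1)"
  shows "bij_betw (\<lambda>x::'a. x ^ a) U U"
proof -
  have "inj_on (\<lambda>x::'a. x ^ a) U"
  proof (rule inj_onI)
    fix x y :: 'a assume xy: "x \<in> U" "y \<in> U" "x ^ a = y ^ a"
    obtain i j where ij: "x = g ^ i" "y = g ^ j" using xy g_power_cases by (metis Diff_iff singletonI)
    hence "g ^ (a * i) = g ^ (a * j)" using xy by (simp add: mult.commute flip: power_mult)
    hence "[a * i = a * j] (mod (q - 1))" by (simp only: g_power_eq_iff cong_def)
    hence "[i = j] (mod (q - 1))" using assms by (simp only: cong_mult_lcancel_nat)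
    thus "x = y" unfolding ij by (simp only: g_power_eq_iff cong_def)
  qed
  moreover have "(\<lambda>x::'a. x ^ a) ` U \<subseteq> U" by auto
  ultimately show ?thesis by (simp add: bij_betw_def endo_inj_surj)
qed

lemma power_d_bij: "bij (\<lambda>x::'a. x ^ d)"
proof -
  have "bij_betw (\<lambda>x::'a. x ^ d) (insert 0 U) (insert 0 U)"
    using notIn_Un_bij_betw[OF _ _ coprime_power_bij[OF coprime_d], of 0] d by (simp add: insert_UNIV)
  moreover have "insert (0::'a) U = UNIV" by auto
  ultimately show ?thesis by simp
qed

lemma W_0: "W 0 = 0"
proof -
  have "W 0 = (\<Sum>x\<in>UNIV. \<psi> x)"
    unfolding weil_sum_def by (simp add: sum.reindex_bij_betw[OF power_d_bij, of \<psi>])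
  thus ?thesis by (simp add: sum_psi_eq_0)
qed

lemma W_altdef: "W a = (\<Sum>x\<in>UNIV. \<psi> (x ^ d) * \<psi> (- x * a))"
  by (simp add: weil_sum_def mult.commute flip: psi_add)

text \<open>As \<open>d\<close> is odd, negating \<open>x\<close> negates the argument of
  \<open>\<psi>\<close>, so the traces 1 and 2 occur equally often. Then \<open>w\<close> and
  \<open>w ^ 2\<close> have the same coefficient, and their sum is \<open>- 1\<close>.\<close>

lemma W_int: "W a \<in> \<int>"
proof -
  define N where "N k = card {x. abs_trace_nat (x ^ d - a * x) = k}" for k
  have "bij_betw uminus {x. abs_trace_nat (x ^ d - a * x) = 1} {x. abs_trace_nat (x ^ d - a * x) = 2}"
  proof (rule bij_betwI[where g = uminus])
    have neg: "abs_trace ((- x) ^ d - a * (- x)) = - abs_trace (x ^ d - a * x)" for x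
      using trace_uminus[of "x ^ d - a * x"] odd_d by (simp add: power_minus_odd)
    have m: "abs_trace_nat y = 1 \<longleftrightarrow> abs_trace y = 1" "abs_trace_nat y = 2 \<longleftrightarrow> abs_trace y = - 1" for y :: 'a
    proof -
      have two: "(2::'a) = - 1" using three_eq_0 by (simp add: eq_neg_iff_add_eq_0)
      show "abs_trace_nat y = 1 \<longleftrightarrow> abs_trace y = 1"
        using trace_nat[of y] of_nat_eq_iff_mod_3[of "abs_trace_nat y" 1] by simp
      show "abs_trace_nat y = 2 \<longleftrightarrow> abs_trace y = - 1"
        using trace_nat[of y] of_nat_eq_iff_mod_3[of "abs_trace_nat y" 2] by (simp add: two)
    qed
    show "uminus \<in> {x. abs_trace_nat (x ^ d - a * x) = 1} \<rightarrow> {x. abs_trace_nat (x ^ d - a * x) = 2}"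
      "uminus \<in> {x. abs_trace_nat (x ^ d - a * x) = 2} \<rightarrow> {x. abs_trace_nat (x ^ d - a * x) = 1}"
      unfolding m Pi_def mem_Collect_eq neg by auto
  qed auto
  hence N12: "N 1 = N 2" unfolding N_def by (rule bij_betw_same_card)
  have "W a = (\<Sum>x\<in>UNIV. \<Sum>k<3. if abs_trace_nat (x ^ d - a * x) = k then w ^ k else 0)"
    unfolding weil_sum_def using trace_nat(1) by (intro sum.cong) (auto simp: psi_altdef)
  also have "\<dots> = (\<Sum>k<3. of_nat (N k) * w ^ k)"
    by (subst sum.swap) (simp add: N_def sum.If_cases)
  also have "\<dots> = of_nat (N 0) + of_nat (N 1) * (w + w ^ 2)"
    by (simp add: numeral_3_eq_3 N12 power2_eq_square algebra_simps)
      (simp add: N12[symmetric, simplified] numeral_2_eq_2[symmetric] algebra_simps)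
  also have "w + w ^ 2 = - 1" by (simp add: w_sq)
  finally show ?thesis by simp
qed

lemma sum_psi_mult': "(\<Sum>a\<in>UNIV. \<psi> (- x * a)) = (if x = 0 then of_nat q else 0)"
  using sum_psi_mult[of "- x"] by simp

lemma W_moment_1: "(\<Sum>a\<in>UNIV. W a) = of_nat q"
proof -
  have "(\<Sum>a\<in>UNIV. W a) = (\<Sum>x\<in>UNIV. \<psi> (x ^ d) * (\<Sum>a\<in>UNIV. \<psi> (- x * a)))"
    unfolding W_altdef by (subst sum.swap) (simp add: sum_distrib_left)
  also have "\<dots> = (\<Sum>x\<in>(UNIV::'a set). if x = 0 then of_nat q else 0)"
    by (rule sum.cong[OF refl]) (subst sum_psi_mult', use odd_d in \<open>auto simp: power_0_left\<close>)
  finally show ?thesis by simp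
qed

lemma W_power:
  "W a ^ 2 = (\<Sum>(x, y)\<in>UNIV. \<psi> (x ^ d + y ^ d) * \<psi> (- (x + y) * a))"
  "W a ^ 4 = (\<Sum>(x, y, u, v)\<in>UNIV. \<psi> (x ^ d + y ^ d + u ^ d + v ^ d) * \<psi> (- (x + y + u + v) * a))"
proof -
  let ?f = "\<lambda>x. \<psi> (x ^ d) * \<psi> (- x * a)"
  have prod: "(\<Sum>x\<in>UNIV. f x) * (\<Sum>y\<in>UNIV. h y) = (\<Sum>(x, y)\<in>UNIV. f x * h y)"
    for f :: "'a \<Rightarrow> complex" and h :: "'c::finite \<Rightarrow> complex"
    by (simp add: sum_product sum.cartesian_product)
  have "W a ^ 2 = (\<Sum>(x, y)\<in>UNIV. ?f x * ?f y)"
    unfolding power2_eq_square W_altdef by (rule prod)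
  thus "W a ^ 2 = (\<Sum>(x, y)\<in>UNIV. \<psi> (x ^ d + y ^ d) * \<psi> (- (x + y) * a))"
    by (simp only: psi_add distrib_right distrib_left minus_add_distrib mult_ac)
  have "W a ^ 4 = W a * (W a * (W a * W a))" by (simp add: numeral_eq_Suc mult.assoc)
  also have "\<dots> = (\<Sum>(x, y, u, v)\<in>UNIV. ?f x * (?f y * (?f u * ?f v)))"
    unfolding W_altdef by (simp only: prod split_def)
  finally show "W a ^ 4 = (\<Sum>(x, y, u, v)\<in>UNIV. \<psi> (x ^ d + y ^ d + u ^ d + v ^ d) * \<psi> (- (x + y + u + v) * a))"
    by (simp only: psi_add distrib_right distrib_left minus_add_distrib mult_ac)
qed

lemma sum_zero_sum: "(\<Sum>a\<in>UNIV. \<Sum>x\<in>UNIV. f x * \<psi> (- h x * a)) = of_nat q * (\<Sum>x | h x = 0. f x)"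
  for f :: "'c::finite \<Rightarrow> complex"
proof -
  have "(\<Sum>a\<in>UNIV. \<Sum>x\<in>UNIV. f x * \<psi> (- h x * a)) = (\<Sum>x\<in>UNIV. f x * (\<Sum>a\<in>UNIV. \<psi> (- h x * a)))"
    by (subst sum.swap) (simp add: sum_distrib_left)
  also have "\<dots> = (\<Sum>x\<in>UNIV. if h x = 0 then of_nat q * f x else 0)"
    by (intro sum.cong refl) (subst sum_psi_mult', simp)
  also have "\<dots> = of_nat q * (\<Sum>x | h x = 0. f x)"
    by (simp add: sum.If_cases sum_distrib_left)
  finally show ?thesis .
qed

text \<open>Orthogonality leaves the pairs \<open>(x, - x)\<close>, for which the two powers cancel
  because \<open>d\<close> is odd.\<close>

lemma W_moment_2: "(\<Sum>a\<in>UNIV. W a ^ 2) = of_nat q ^ 2"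
proof -
  have "(\<Sum>a\<in>UNIV. W a ^ 2) = of_nat q * (\<Sum>x | fst x + snd x = 0. \<psi> (fst x ^ d + snd x ^ d))"
    unfolding W_power split_def by (rule sum_zero_sum)
  also have "(\<Sum>x | fst x + snd x = 0. \<psi> (fst x ^ d + snd x ^ d)) = (\<Sum>x\<in>(UNIV::'a set). \<psi> 0)"
    by (rule sum.reindex_bij_witness[of _ "\<lambda>x. (x, - x)" fst])
      (use odd_d in \<open>auto simp: add_eq_0_iff power_minus_odd\<close>)
  finally show ?thesis by (simp add: card_field power2_eq_square)
qed

end

section \<open>The fourth moment\<close>

context weil_exponent
begin

abbreviation Q :: nat where "Q \<equiv> 3 ^ r"

lemma two_eq: "(2 :: 'a) = - 1"
  using three_eq_0 by (simp add: eq_neg_iff_add_eq_0)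

lemma double_eq: "x + x = - (x :: 'a)"
  using two_eq by (metis mult_2 mult_minus1)

lemma power_q_power: "(x :: 'a) ^ (3 ^ (n * m)) = x"
proof (induction m)
  case (Suc m)
  have "x ^ (3 ^ (n * Suc m)) = (x ^ (3 ^ (n * m))) ^ q"
    by (simp add: q power_add mult.commute flip: power_mult)
  thus ?case using Suc by simp
qed simp

text \<open>A twisted form of the identity expressing \<open>24 * u * v * t\<close> by four signed
  cubes. The four arguments sum to zero, so this evaluates the terms of the fourth moment.\<close>

lemma cubic_polarization:
  fixes u v t :: 'a
  shows "(- (u + v - t)) ^ d + (- (u - v + t)) ^ d + (- (v + t - u)) ^ d + (u + v + t) ^ d
    = - (u ^ Q * v * t + u * v ^ Q * t + u * v * t ^ Q)"
proof -
  have pd: "x ^ d = x ^ Q * x ^ 2" for x :: 'a by (simp add: d power_add power2_eq_square)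
  have neg: "(- x) ^ Q = - (x ^ Q)" for x :: 'a by (simp add: power_minus_odd)
  have diff: "(x - y) ^ Q = x ^ Q - y ^ Q" for x y :: 'a
    using frobenius_add[of x "- y" r] by (simp add: neg)
  have eight: "(8 :: 'a) * x = - x" for x
  proof -
    have "8 * x = 3 * (3 * x) - x" by (simp add: algebra_simps)
    thus ?thesis by (simp add: three_eq_0)
  qed
  \<comment> \<open>The \<open>Q\<close>-th powers are replaced by independent variables, since the
    identity needs only their additivity. The coefficient \<open>8\<close> is \<open>- 1\<close> in
    characteristic 3.\<close>
  have "- (u' + v' - t') * (- (u + v - t)) ^ 2 + - (u' - v' + t') * (- (u - v + t)) ^ 2
      + - (v' + t' - u') * (- (v + t - u)) ^ 2 + (u' + v' + t') * (u + v + t) ^ 2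
      = 8 * (u' * v * t + u * v' * t + u * v * t')" for u' v' t' :: 'a
    by (simp add: power2_eq_square algebra_simps)
  thus ?thesis unfolding pd neg diff frobenius_add eight .
qed

text \<open>Raising to the power \<open>3 ^ twist\<close> extracts \<open>Q\<close>-th roots:
  \<open>twist\<close> is \<open>- r\<close> modulo \<open>n\<close>.\<close>

definition twist :: nat where "twist = (n - 1) * r"

lemma frobenius_twist: "(x :: 'a) ^ (Q * 3 ^ twist) = x"
proof -
  have "r + twist = n * r" using n by (simp add: twist_def diff_mult_distrib)
  thus ?thesis using power_q_power[of x r] by (simp flip: power_add)
qed

text \<open>Quadruples \<open>(a, b, c, e)\<close> of sum zero are parametrized by the pair sums
  \<open>u = a + b\<close>, \<open>v = a + c\<close>, \<open>t = b + c\<close>, which is invertible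
  because \<open>2 = - 1\<close>. One factor \<open>q\<close> comes from the sum over the argument
  of \<open>W\<close>, the other from the sum over \<open>t\<close>.\<close>

lemma W_moment_4_zeros:
  "(\<Sum>a\<in>UNIV. W a ^ 4) = of_nat q ^ 2 *
     of_nat (card {(u, v). u ^ Q * v + u * v ^ Q + (u * v) ^ (3 ^ twist) = (0 :: 'a)})"
proof -
  define h where "h u v = u ^ Q * v + u * v ^ Q + (u * v) ^ (3 ^ twist)" for u v :: 'a
  define F where "F u v t = \<psi> (- (u ^ Q * v * t + u * v ^ Q * t + u * v * t ^ Q))" for u v t
  have F: "F u v t = \<psi> (- h u v * t)" for u v t
  proof -
    \<comment> \<open>Extracting a \<open>Q\<close>-th root does not change \<open>\<psi>\<close>
      and makes the argument linear in \<open>t\<close>.\<close>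
    have "\<psi> (- (u * v * t ^ Q)) = \<psi> ((- (u * v * t ^ Q)) ^ (3 ^ twist))" by (rule psi_frobenius[symmetric])
    also have "(- (u * v * t ^ Q)) ^ (3 ^ twist) = - ((u * v) ^ (3 ^ twist) * t)"
      by (simp add: power_minus_odd power_mult_distrib frobenius_twist flip: power_mult)
    finally have "\<psi> (- (u * v * t ^ Q)) = \<psi> (- ((u * v) ^ (3 ^ twist) * t))" .
    thus ?thesis unfolding F_def h_def by (simp only: psi_add distrib_right minus_add_distrib minus_mult_left)
  qed
  have "(\<Sum>a\<in>UNIV. W a ^ 4) = of_nat q *
      (\<Sum>x | fst x + fst (snd x) + fst (snd (snd x)) + snd (snd (snd x)) = 0.
        \<psi> (fst x ^ d + fst (snd x) ^ d + fst (snd (snd x)) ^ d + snd (snd (snd x)) ^ d))"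
    unfolding W_power split_def by (rule sum_zero_sum)
  also have "(\<Sum>x | fst x + fst (snd x) + fst (snd (snd x)) + snd (snd (snd x)) = 0.
        \<psi> (fst x ^ d + fst (snd x) ^ d + fst (snd (snd x)) ^ d + snd (snd (snd x)) ^ d))
      = (\<Sum>(u, v, t)\<in>UNIV. F u v t)"
  proof (rule sum.reindex_bij_witness[of _
        "\<lambda>(u, v, t). (- (u + v - t), - (u - v + t), - (v + t - u), u + v + t)"
        "\<lambda>(a, b, c, e). (a + b, a + c, b + c)"])
    fix x :: "'a \<times> 'a \<times> 'a \<times> 'a"
    assume x: "x \<in> {x. fst x + fst (snd x) + fst (snd (snd x)) + snd (snd (snd x)) = 0}"
    obtain a b c e where abce: "x = (a, b, c, e)" by (metis prod.exhaust)
    have "e = - (a + b + c)" using x abce by (simp add: add_eq_0_iff)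
    moreover have "- (a + b + (a + c) - (b + c)) = - (a + a)" "- (a + b - (a + c) + (b + c)) = - (b + b)"
      "- (a + c + (b + c) - (a + b)) = - (c + c)" "a + b + (a + c) + (b + c) = (a + b + c) + (a + b + c)"
      by simp_all
    ultimately show "(case case x of (a, b, c, e) \<Rightarrow> (a + b, a + c, b + c) of
        (u, v, t) \<Rightarrow> (- (u + v - t), - (u - v + t), - (v + t - u), u + v + t)) = x"
      unfolding abce by (simp only: prod.case double_eq minus_minus)
  next
    fix y :: "'a \<times> 'a \<times> 'a"
    obtain u v t where uvt: "y = (u, v, t)" by (metis prod.exhaust)
    have "- (u + v - t) + - (u - v + t) = - (u + u)" "- (u + v - t) + - (v + t - u) = - (v + v)"
      "- (u - v + t) + - (v + t - u) = - (t + t)" by simp_all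
    thus "(case case y of (u, v, t) \<Rightarrow> (- (u + v - t), - (u - v + t), - (v + t - u), u + v + t) of
        (a, b, c, e) \<Rightarrow> (a + b, a + c, b + c)) = y"
      unfolding uvt by (simp only: prod.case double_eq minus_minus)
    show "(case y of (u, v, t) \<Rightarrow> (- (u + v - t), - (u - v + t), - (v + t - u), u + v + t))
        \<in> {x. fst x + fst (snd x) + fst (snd (snd x)) + snd (snd (snd x)) = 0}"
      unfolding uvt by simp
  next
    fix x :: "'a \<times> 'a \<times> 'a \<times> 'a"
    assume x: "x \<in> {x. fst x + fst (snd x) + fst (snd (snd x)) + snd (snd (snd x)) = 0}"
    obtain a b c e where abce: "x = (a, b, c, e)" by (metis prod.exhaust)
    have e: "e = - (a + b + c)" using x abce by (simp add: add_eq_0_iff)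
    have "- (a + b + (a + c) - (b + c)) = - (a + a)" "- (a + b - (a + c) + (b + c)) = - (b + b)"
      "- (a + c + (b + c) - (a + b)) = - (c + c)" "a + b + (a + c) + (b + c) = (a + b + c) + (a + b + c)"
      by simp_all
    hence *: "- (a + b + (a + c) - (b + c)) = a" "- (a + b - (a + c) + (b + c)) = b"
      "- (a + c + (b + c) - (a + b)) = c" "a + b + (a + c) + (b + c) = e"
      unfolding e double_eq minus_minus by simp_all
    have "F (a + b) (a + c) (b + c) = \<psi> (a ^ d + b ^ d + c ^ d + e ^ d)"
      unfolding F_def cubic_polarization[symmetric] * ..
    thus "(case case x of (a, b, c, e) \<Rightarrow> (a + b, a + c, b + c) of (u, v, t) \<Rightarrow> F u v t) =
        \<psi> (fst x ^ d + fst (snd x) ^ d + fst (snd (snd x)) ^ d + snd (snd (snd x)) ^ d)"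
      unfolding abce by simp
  qed simp
  also have "(\<Sum>(u, v, t)\<in>UNIV. F u v t) = (\<Sum>u\<in>UNIV. \<Sum>v\<in>UNIV. \<Sum>t\<in>UNIV. \<psi> (- h u v * t))"
    unfolding F by (simp add: sum.cartesian_product split_def)
  also have "\<dots> = (\<Sum>(u, v)\<in>UNIV. if h u v = 0 then of_nat q else 0)"
    unfolding sum_psi_mult' by (simp add: sum.cartesian_product split_def)
  also have "\<dots> = of_nat q * of_nat (card {(u, v). h u v = 0})"
    by (simp add: split_def sum.If_cases mult.commute)
  finally show ?thesis by (simp add: h_def power2_eq_square)
qed

section \<open>Squares, and the points of the circle \<open>x ^ 2 + y ^ 2 = - 1\<close>\<close>

definition h :: nat where "h = (q - 1) div 2"

text \<open>For odd \<open>n\<close> the order \<open>q\<close> is 3 modulo 4; the oddness of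
  \<open>h\<close> is what makes \<open>- 1\<close> a nonsquare.\<close>

lemma half: "q - 1 = 2 * h" "odd h"
proof -
  obtain k where k: "n = 2 * k + 1" using odd_n by (elim oddE)
  have "[9 ^ k * 3 = 1 ^ k * (3::nat)] (mod 4)" by (intro cong_mult cong_pow) (simp_all add: cong_def)
  moreover have "q = 9 ^ k * 3" by (simp add: q k power_add power_mult)
  ultimately have "q mod 4 = 3" by (simp add: cong_def)
  thus "q - 1 = 2 * h" "odd h" unfolding h_def by presburger+
qed

lemma one_ne_minus_one: "(1 :: 'a) \<noteq> - 1"
proof
  assume "(1 :: 'a) = - 1"
  hence "(1 :: 'a) = 2" by (simp only: two_eq)
  thus False by (metis add_cancel_right_left one_add_one zero_neq_one)
qed

lemma power_2h: "(x :: 'a) \<noteq> 0 \<Longrightarrow> x ^ (2 * h) = 1"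
  unfolding half(1)[symmetric] by (rule power_q_1)

lemma minus_one_nonsquare: "(x :: 'a) ^ 2 \<noteq> - 1"
proof
  assume x: "x ^ 2 = - 1"
  hence "x \<noteq> 0" by auto
  hence "(x ^ 2) ^ h = 1" using power_2h[of x] by (simp only: power_mult) simp
  thus False using x half(2) one_ne_minus_one by simp
qed

lemma square_add_one_nonzero: "(x :: 'a) ^ 2 + 1 \<noteq> 0"
  using minus_one_nonsquare[of x] by (simp add: add_eq_0_iff2)

text \<open>Multiplying an odd power of \<open>g\<close> by \<open>g ^ h = - 1\<close> makes the
  exponent even, since \<open>h\<close> is odd.\<close>

lemma square_cases:
  assumes "(x :: 'a) \<noteq> 0" obtains y where "y \<noteq> 0" "x = y ^ 2 \<or> x = - (y ^ 2)"
proof -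
  obtain i where i: "x = g ^ i" using assms by (meson g_power_cases)
  have "(g ^ h) ^ 2 = 1" using power_2h[OF g_nonzero] by (simp add: mult.commute flip: power_mult)
  moreover have "g ^ h \<noteq> 1"
  proof
    assume "g ^ h = 1"
    hence "g ^ h = g ^ 0" by simp
    hence "h mod (q - 1) = 0" by (simp only: g_power_eq_iff) simp
    thus False using half q_gt by auto
  qed
  ultimately have gh: "g ^ h = - 1" by (simp add: power2_eq_1_iff)
  show ?thesis
  proof (cases "even i")
    case True
    then obtain k where "i = 2 * k" by auto
    thus ?thesis using that[of "g ^ k"] i by (simp add: mult.commute flip: power_mult)
  next
    case False
    hence "even (i + h)" using half by simp
    then obtain k where k: "i + h = 2 * k" by (rule evenE)
    have "- x = g ^ (i + h)" by (simp add: i gh power_add)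
    hence "- x = (g ^ k) ^ 2" by (simp add: k mult.commute flip: power_mult)
    hence "x = - ((g ^ k) ^ 2)" by (metis minus_minus)
    thus ?thesis using that[of "g ^ k"] by simp
  qed
qed

text \<open>All nonzero values of \<open>x\<^sup>2 + y\<^sup>2\<close> are taken equally often: nonzero elements are squares up to sign,
  and \<open>(x, y) \<mapsto> (x - y, x + y)\<close> multiplies the value by \<open>2 = -1\<close>.\<close>

lemma card_circle: "card {(x, y). x ^ 2 + y ^ 2 = (- 1 :: 'a)} = q + 1"
proof -
  define N where "N c = card {(x, y). x ^ 2 + y ^ 2 = (c :: 'a)}" for c
  have N_neg: "N (- c) = N c" for c
    unfolding N_def
  proof (rule bij_betw_same_card[of "\<lambda>(x, y). (- (x + y), x - y)"],
      rule bij_betwI[where g = "\<lambda>(x, y). (x - y, x + y)"])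
    have "(- (x + y)) ^ 2 + (x - y) ^ 2 = 2 * (x ^ 2 + y ^ 2)"
      "(x - y) ^ 2 + (x + y) ^ 2 = 2 * (x ^ 2 + y ^ 2)" for x y :: 'a
      by (simp_all add: power2_eq_square algebra_simps)
    hence *: "(- (x + y)) ^ 2 + (x - y) ^ 2 = - (x ^ 2 + y ^ 2)"
      "(x - y) ^ 2 + (x + y) ^ 2 = - (x ^ 2 + y ^ 2)" for x y :: 'a
      by (simp_all only: two_eq mult_minus1)
    show "(\<lambda>(x, y). (- (x + y), x - y)) \<in> {(x, y). x ^ 2 + y ^ 2 = - c} \<rightarrow> {(x, y). x ^ 2 + y ^ 2 = c}"
      unfolding Pi_def split_def mem_Collect_eq fst_conv snd_conv * by (metis minus_minus)
    show "(\<lambda>(x, y). (x - y, x + y)) \<in> {(x, y). x ^ 2 + y ^ 2 = c} \<rightarrow> {(x, y). x ^ 2 + y ^ 2 = - c}"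
      unfolding Pi_def split_def mem_Collect_eq fst_conv snd_conv * by metis
    have **: "- (x + y) - (x - y) = x" "- (x + y) + (x - y) = y"
      "- ((x - y) + (x + y)) = x" "(x - y) - (x + y) = y" for x y :: 'a
    proof -
      have "- (x + y) - (x - y) = - (x + x)" "- (x + y) + (x - y) = - (y + y)"
        "- ((x - y) + (x + y)) = - (x + x)" "(x - y) - (x + y) = - (y + y)" by simp_all
      thus "- (x + y) - (x - y) = x" "- (x + y) + (x - y) = y"
        "- ((x - y) + (x + y)) = x" "(x - y) - (x + y) = y" unfolding double_eq by simp_all
    qed
    show "(case case p of (x, y) \<Rightarrow> (- (x + y), x - y) of (x, y) \<Rightarrow> (x - y, x + y)) = p" for p :: "'a \<times> 'a"
      by (cases p) (simp only: prod.case **)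
    show "(case case p of (x, y) \<Rightarrow> (x - y, x + y) of (x, y) \<Rightarrow> (- (x + y), x - y)) = p" for p :: "'a \<times> 'a"
      by (cases p) (simp only: prod.case **)
  qed
  have N_scale: "N (l ^ 2 * c) = N c" if "l \<noteq> 0" for l c
    unfolding N_def
  proof (rule bij_betw_same_card[of "\<lambda>(x, y). (x / l, y / l)"],
      rule bij_betwI[where g = "\<lambda>(x, y). (l * x, l * y)"])
    show "(\<lambda>(x, y). (x / l, y / l)) \<in> {(x, y). x ^ 2 + y ^ 2 = l ^ 2 * c} \<rightarrow> {(x, y). x ^ 2 + y ^ 2 = c}"
      using that by (auto simp: power_divide simp flip: add_divide_distrib)
    show "(\<lambda>(x, y). (l * x, l * y)) \<in> {(x, y). x ^ 2 + y ^ 2 = c} \<rightarrow> {(x, y). x ^ 2 + y ^ 2 = l ^ 2 * c}"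
      by (auto simp: power_mult_distrib distrib_left)
  qed (use that in auto)
  have N_const: "N c = N (- 1)" if "c \<noteq> 0" for c
  proof -
    obtain y where "y \<noteq> 0" "c = y ^ 2 \<or> c = - (y ^ 2)" using square_cases[OF \<open>c \<noteq> 0\<close>] by blast
    thus ?thesis using N_scale[of y 1] N_neg[of 1] N_neg[of "y ^ 2"] by auto
  qed
  have "{(x, y). x ^ 2 + y ^ 2 = (0 :: 'a)} = {(0, 0)}"
  proof -
    have y0: "y = 0" if "x ^ 2 + y ^ 2 = 0" for x y :: 'a
    proof (rule ccontr)
      assume "y \<noteq> 0"
      hence "(x / y) ^ 2 = - 1" using that by (simp add: power_divide field_simps add_eq_0_iff2)
      thus False using minus_one_nonsquare by blast
    qed
    have x0: "x = 0" if "x ^ 2 + y ^ 2 = 0" for x y :: 'a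
      by (rule y0[of y]) (use that in \<open>simp only: add.commute\<close>)
    show ?thesis by (auto dest: x0 y0)
  qed
  hence N0: "N 0 = 1" by (simp add: N_def)
  have "q * q = card (UNIV :: ('a \<times> 'a) set)" by (simp add: card_field)
  also have "\<dots> = (\<Sum>c\<in>UNIV. N c)"
    unfolding N_def using sum.group[of "UNIV :: ('a \<times> 'a) set" "UNIV :: 'a set" "\<lambda>(x, y). x ^ 2 + y ^ 2" "\<lambda>_. 1 :: nat"]
    by (simp add: split_def)
  also have "\<dots> = N 0 + (\<Sum>c\<in>U. N c)" by (rule sum.remove) auto
  also have "(\<Sum>c\<in>U. N c) = (\<Sum>c\<in>U. N (- 1))" by (intro sum.cong refl N_const) auto
  also have "\<dots> = (q - 1) * N (- 1)" by (simp add: card_Diff_subset card_field)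
  finally have "q * q = 1 + (q - 1) * N (- 1)" by (simp add: N0)
  moreover obtain m where m: "q = Suc m" "m > 0" using q_gt by (cases q) auto
  ultimately have "m * N (- 1) = m * (q + 1)" by (simp add: algebra_simps)
  hence "N (- 1) = q + 1" by (simp only: nat_mult_eq_cancel1[OF m(2)])
  thus ?thesis by (simp only: N_def)
qed

text \<open>Since \<open>gcd (Q - 1) (q - 1)\<close> divides 2, the power map with exponent
  \<open>Q - 1\<close> is squaring after a permutation of the units. This is what makes the cubic
  equation quadratic.\<close>

lemma square_reparametrization: "\<exists>a. coprime a (q - 1) \<and> (\<forall>x::'a. x \<noteq> 0 \<longrightarrow> x ^ (Q - 1) = (x ^ a) ^ 2)"
proof -
  define e where "e = (Q - 1) div 2"
  have e: "Q - 1 = 2 * e" by (simp add: e_def)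
  have "gcd (Q - 1) (q - 1) dvd 2" using exponent_gcds(2)[OF n r] by (simp only: q)
  hence "2 * gcd e h dvd 2" by (simp only: e half(1) gcd_mult_distrib_nat)
  hence "gcd e h dvd 1" by (metis mult.right_neutral nat_mult_dvd_cancel_disj zero_neq_numeral)
  hence cop: "coprime e h" by (simp only: is_unit_gcd)
  \<comment> \<open>Adding \<open>h\<close> leaves the square of \<open>x ^ a\<close> unchanged,
    because \<open>x ^ (2 * h) = 1\<close>, and corrects the parity of the exponent.\<close>
  define a where "a = (if odd e then e else e + h)"
  have "odd a" using half(2) by (simp add: a_def)
  moreover have "coprime a h"
  proof (cases "odd e")
    case False
    have "coprime (e + h) h" using cop by (simp only: coprime_iff_gcd_eq_1 gcd_add1)
    thus ?thesis using False by (simp add: a_def)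
  qed (use cop in \<open>simp add: a_def\<close>)
  ultimately have "coprime a (q - 1)" by (simp only: half(1) coprime_mult_right_iff coprime_right_2_iff_odd not_False_eq_True simp_thms)
  moreover have "x ^ (Q - 1) = (x ^ a) ^ 2" if "x \<noteq> 0" for x :: 'a
  proof -
    have "(x ^ a) ^ 2 = x ^ (2 * a)" by (simp add: mult.commute flip: power_mult)
    also have "\<dots> = x ^ (2 * e)"
      using power_2h[OF that] by (simp add: a_def distrib_left power_add)
    finally show ?thesis by (simp only: e)
  qed
  ultimately show ?thesis by blast
qed

text \<open>The two axes contribute \<open>2 * q - 1\<close> zeros. Off the axes put
  \<open>v = t * u\<close>; after permuting the values of \<open>t\<close> and of \<open>u\<close>
  by coprime powers, the equation becomes that of the circle, which has \<open>q + 1\<close>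
  points.\<close>

lemma card_cubic_zeros:
  "card {(u, v). u ^ Q * v + u * v ^ Q + (u * v) ^ (3 ^ twist) = (0 :: 'a)} = 3 * q"
proof -
  define H where "H u v = u ^ Q * v + u * v ^ Q + (u * v) ^ (3 ^ twist)" for u v :: 'a
  define K where "K u v = (u ^ Q * v + u * v ^ Q) ^ Q + u * v" for u v :: 'a
  have "H u v ^ Q = K u v" for u v
    by (simp only: H_def K_def frobenius_add[of _ _ r] power_mult[symmetric] mult.commute[of "3 ^ twist"] frobenius_twist)
  hence HK: "H u v = 0 \<longleftrightarrow> K u v = 0" for u v by (metis power_eq_0_iff zero_less_numeral zero_less_power)
  obtain p where p: "Q = Suc p" using not0_implies_Suc[of Q] by auto
  obtain a where a: "coprime a (q - 1)" "\<And>x. x \<noteq> 0 \<Longrightarrow> (x :: 'a) ^ p = (x ^ a) ^ 2"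
    using square_reparametrization p by auto
  \<comment> \<open>Besides \<open>u ^ 2\<close>, the power of \<open>u\<close> that occurs is
    \<open>(Q + 1) * Q - 2 = (Q - 1) * (Q + 2) = p * d\<close>, which brings in the factor
    \<open>d\<close>.\<close>
  define b where "b = a * d"
  have b: "coprime b (q - 1)" using a(1) coprime_d by (simp add: b_def)
  obtain k where k: "Q + 1 = 2 * k" by (metis evenE even_add even_power odd_numeral odd_one)
  \<comment> \<open>Multiplying \<open>P t u\<close> by the nonzero \<open>t ^ 2 + 1\<close> raises
    the exponent \<open>Q\<close> to the even number \<open>2 * k\<close>, so that the left side
    becomes the square of \<open>u * m t\<close>.\<close>
  define m where "m t = t * (t ^ 2 + 1) ^ k" for t :: 'a
  define P where "P t u \<longleftrightarrow> u ^ 2 * t ^ 2 * (t ^ 2 + 1) ^ Q = (- 1 :: 'a)" for t u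
  have K: "K u (t * u) = 0 \<longleftrightarrow> P (t ^ a) (u ^ b)" if "t \<noteq> 0" "u \<noteq> 0" for t u
  proof -
    have "K u (t * u) = (u ^ Q * u * t * (t ^ p + 1)) ^ Q + u ^ 2 * t"
      by (simp add: K_def p power_mult_distrib power2_eq_square algebra_simps)
    also have "\<dots> = (u ^ Q * u) ^ Q * t ^ Q * (t ^ p + 1) ^ Q + u ^ 2 * t"
      by (simp only: power_mult_distrib)
    also have "(u ^ Q * u) ^ Q = u ^ 2 * (u ^ p) ^ d"
    proof -
      have "(u ^ Q * u) ^ Q = u ^ ((Q + 1) * Q)" by (simp only: power_add power_mult power_one_right)
      also have "(Q + 1) * Q = 2 + p * d" unfolding d p by simp
      finally show ?thesis by (simp only: power_add power_mult)
    qed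
    also have "(u ^ p) ^ d = (u ^ b) ^ 2"
      using a(2)[OF that(2)] by (simp add: b_def mult_ac flip: power_mult)
    also have "t ^ Q = t * (t ^ a) ^ 2" using a(2)[OF that(1)] by (simp add: p)
    also have "t ^ p = (t ^ a) ^ 2" using a(2)[OF that(1)] .
    finally have "K u (t * u) = u ^ 2 * t * ((u ^ b) ^ 2 * (t ^ a) ^ 2 * ((t ^ a) ^ 2 + 1) ^ Q + 1)"
      by (simp add: algebra_simps)
    thus ?thesis using that by (simp add: P_def eq_neg_iff_add_eq_0)
  qed
  define A where "A = {(u, v). u \<noteq> 0 \<and> v \<noteq> 0 \<and> K u v = 0}"
  have "bij_betw (\<lambda>(t, u). (u, t * u)) {(t, u). t \<noteq> 0 \<and> u \<noteq> 0 \<and> P (t ^ a) (u ^ b)} A"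
    by (rule bij_betwI[where g = "\<lambda>(u, v). (v / u, u)"]) (auto simp: A_def K simp flip: K)
  hence "card A = card {(t, u). t \<noteq> 0 \<and> u \<noteq> 0 \<and> P (t ^ a) (u ^ b)}"
    by (rule bij_betw_same_card[symmetric])
  also have "\<dots> = card {(t, u). t \<noteq> 0 \<and> u \<noteq> 0 \<and> P t u}"
  proof (rule bij_betw_same_card)
    have "bij_betw (map_prod (\<lambda>t. t ^ a) (\<lambda>u. u ^ b)) (U \<times> U) (U \<times> U)"
      by (intro bij_betw_map_prod coprime_power_bij a b)
    hence "bij_betw (map_prod (\<lambda>t. t ^ a) (\<lambda>u. u ^ b))
      {x \<in> U \<times> U. P (fst (map_prod (\<lambda>t. t ^ a) (\<lambda>u. u ^ b) x)) (snd (map_prod (\<lambda>t. t ^ a) (\<lambda>u. u ^ b) x))}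
      {y \<in> U \<times> U. P (fst y) (snd y)}"
      by (rule bij_betw_Collect) simp
    moreover have "{x \<in> U \<times> U. P (fst (map_prod (\<lambda>t. t ^ a) (\<lambda>u. u ^ b) x)) (snd (map_prod (\<lambda>t. t ^ a) (\<lambda>u. u ^ b) x))} =
      {(t, u). t \<noteq> 0 \<and> u \<noteq> 0 \<and> P (t ^ a) (u ^ b)}" by auto
    moreover have "{y \<in> U \<times> U. P (fst y) (snd y)} = {(t, u). t \<noteq> 0 \<and> u \<noteq> 0 \<and> P t u}" by auto
    ultimately show "bij_betw (map_prod (\<lambda>t. t ^ a) (\<lambda>u. u ^ b))
      {(t, u). t \<noteq> 0 \<and> u \<noteq> 0 \<and> P (t ^ a) (u ^ b)} {(t, u). t \<noteq> 0 \<and> u \<noteq> 0 \<and> P t u}" by simp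
  qed
  also have "\<dots> = card {(x, y). x ^ 2 + y ^ 2 = (- 1 :: 'a)}"
  proof (rule bij_betw_same_card)
    have m: "m t \<noteq> 0" if "t \<noteq> 0" for t using that square_add_one_nonzero[of t] by (simp add: m_def)
    have nz: "t \<noteq> 0" "u \<noteq> 0" if "t ^ 2 + u ^ 2 = - 1" for t u :: 'a
      using that minus_one_nonsquare[of t] minus_one_nonsquare[of u] by auto
    have P: "P t u \<longleftrightarrow> t ^ 2 + (u * m t) ^ 2 = - 1" for t u
    proof -
      have "(u * m t) ^ 2 = u ^ 2 * t ^ 2 * (t ^ 2 + 1) ^ (Q + 1)"
        unfolding k by (simp add: m_def power_mult_distrib mult_ac flip: power_mult)
      also have "\<dots> = (u ^ 2 * t ^ 2 * (t ^ 2 + 1) ^ Q) * (t ^ 2 + 1)" by simp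
      finally have "t ^ 2 + (u * m t) ^ 2 + 1 = (u ^ 2 * t ^ 2 * (t ^ 2 + 1) ^ Q + 1) * (t ^ 2 + 1)"
        by (simp add: algebra_simps)
      thus ?thesis using square_add_one_nonzero[of t] unfolding P_def eq_neg_iff_add_eq_0 by simp
    qed
    show "bij_betw (\<lambda>(t, u). (t, u * m t)) {(t, u). t \<noteq> 0 \<and> u \<noteq> 0 \<and> P t u} {(x, y). x ^ 2 + y ^ 2 = - 1}"
    proof (rule bij_betwI[where g = "\<lambda>(t, y). (t, y / m t)"])
      show "(\<lambda>(t, u). (t, u * m t)) \<in> {(t, u). t \<noteq> 0 \<and> u \<noteq> 0 \<and> P t u} \<rightarrow> {(x, y). x ^ 2 + y ^ 2 = - 1}"
        by (auto simp: P)
      show "(\<lambda>(t, y). (t, y / m t)) \<in> {(x, y). x ^ 2 + y ^ 2 = - 1} \<rightarrow> {(t, u). t \<noteq> 0 \<and> u \<noteq> 0 \<and> P t u}"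
        using nz m by (auto simp: P)
    qed (use m nz in auto)
  qed
  also have "\<dots> = q + 1" by (rule card_circle)
  finally have A: "card A = q + 1" .
  have "{(u, v). K u v = 0} = A \<union> (UNIV \<times> {0} \<union> {0} \<times> U)"
    by (auto simp: A_def K_def power_0_left)
  moreover have "card (A \<union> (UNIV \<times> {0} \<union> {0} \<times> U)) = card A + card (UNIV \<times> {0::'a} \<union> {0::'a} \<times> U)"
    by (rule card_Un_disjoint) (auto simp: A_def)
  moreover have "card (UNIV \<times> {0::'a} \<union> {0::'a} \<times> U) = card (UNIV \<times> {0::'a} :: ('a \<times> 'a) set) + card ({0::'a} \<times> U)"
    by (rule card_Un_disjoint) auto
  ultimately have "card {(u, v). K u v = 0} = q + 1 + (q + (q - 1))"
    by (simp add: A card_cartesian_product card_field card_Diff_subset)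
  thus ?thesis using q_gt HK by (simp add: H_def)
qed

lemma W_moment_4: "(\<Sum>a\<in>UNIV. W a ^ 4) = 3 * of_nat q ^ 3"
  by (simp add: W_moment_4_zeros card_cubic_zeros power2_eq_square power3_eq_cube)

end

section \<open>Distribution of the values\<close>

context weil_exponent
begin

lemma sqrt_3q: "\<exists>m. n + 1 = 2 * m \<and> sqrt (3 * real q) = 3 ^ m \<and> 3 * q = (3 ^ m) ^ 2"
proof -
  obtain m where m: "n + 1 = 2 * m" using odd_n by (metis evenE even_plus_one_iff)
  have "3 * q = 3 ^ (n + 1)" by (simp add: q)
  hence *: "3 * q = (3 ^ m) ^ 2" unfolding m by (simp add: power_mult mult.commute flip: power_mult)
  have "3 * real q = real (3 * q)" by simp
  also have "\<dots> = (3 ^ m) ^ 2" unfolding * by simp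
  finally have "sqrt (3 * real q) = 3 ^ m" by (simp add: real_sqrt_unique)
  thus ?thesis using m * by blast
qed

lemma W_values:
  obtains k :: "'a \<Rightarrow> int" and m :: nat where
    "\<And>a. W a = of_int (k a)" "\<And>a. k a = 0 \<or> k a = 3 ^ m \<or> k a = - (3 ^ m)"
    "sqrt (3 * real q) = 3 ^ m" "3 * q = (3 ^ m) ^ 2"
    "(\<Sum>a\<in>UNIV. k a) = int q" "(\<Sum>a\<in>UNIV. k a ^ 2) = int q ^ 2" "k 0 = 0"
proof -
  obtain m where m: "n + 1 = 2 * m" "sqrt (3 * real q) = 3 ^ m" "3 * q = (3 ^ m) ^ 2"
    using sqrt_3q by blast
  have "\<forall>a. \<exists>k. W a = of_int k" using W_int by (metis Ints_cases)
  then obtain k where k: "\<And>a. W a = of_int (k a)" by metis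
  have k0: "k 0 = 0" using W_0 k[of 0] by simp
  have sums: "(\<Sum>a\<in>UNIV. k a) = int q" "(\<Sum>a\<in>UNIV. k a ^ 2) = int q ^ 2"
    "(\<Sum>a\<in>UNIV. k a ^ 4) = 3 * int q ^ 3"
  proof -
    have "(of_int (\<Sum>a\<in>UNIV. k a) :: complex) = of_int (int q)" using W_moment_1 by (simp add: k)
    thus "(\<Sum>a\<in>UNIV. k a) = int q" by (simp only: of_int_eq_iff)
    have "(of_int (\<Sum>a\<in>UNIV. k a ^ 2) :: complex) = of_int (int q ^ 2)" using W_moment_2 by (simp add: k)
    thus "(\<Sum>a\<in>UNIV. k a ^ 2) = int q ^ 2" by (simp only: of_int_eq_iff)
    have "(of_int (\<Sum>a\<in>UNIV. k a ^ 4) :: complex) = of_int (3 * int q ^ 3)" using W_moment_4 by (simp add: k)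
    thus "(\<Sum>a\<in>UNIV. k a ^ 4) = 3 * int q ^ 3" by (simp only: of_int_eq_iff)
  qed
  have dvd: "3 ^ m dvd k a" for a
  proof (cases "a = 0")
    case False
    \<comment> \<open>Since \<open>n + 1 = 2 * m\<close>, this valuation means divisibility by
      exactly the \<open>3 ^ m = sqrt (3 * q)\<close> required.\<close>
    have "lam_dvd (n + 1) (W a)"
    proof (rule lam_dvd_weil_sum[OF False _ coprime_d])
      fix i j assume "0 < i" "i < q - 1" "0 < j" "j < q - 1" "(q - 1) dvd d * i + j"
      thus "n + 1 \<le> digit_sum i + digit_sum j"
        by (intro digit_sum_bound[OF odd_n n r]) (simp_all only: q d)
    qed (use n in \<open>simp_all add: d\<close>)
    thus ?thesis unfolding k m(1) by (rule lam_dvd_of_int)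
  qed (simp add: k0)
  have q3: "3 * int q = (3 ^ m) ^ 2" using m(3) by (metis of_nat_mult of_nat_numeral of_nat_power)
  have nonneg: "k a ^ 2 * (k a ^ 2 - 3 * int q) \<ge> 0" for a
  proof (cases "k a = 0")
    case False
    hence "3 ^ m \<le> \<bar>k a\<bar>" using dvd_imp_le_int[OF False dvd] by simp
    hence "(3 ^ m) ^ 2 \<le> \<bar>k a\<bar> ^ 2" by (rule power_mono) simp
    thus ?thesis unfolding q3 by simp
  qed simp
  have "(\<Sum>a\<in>UNIV. k a ^ 2 * (k a ^ 2 - 3 * int q)) =
      (\<Sum>a\<in>UNIV. k a ^ 4) - 3 * int q * (\<Sum>a\<in>UNIV. k a ^ 2)"
    unfolding sum_distrib_left sum_subtractf[symmetric]
    by (intro sum.cong refl) (simp add: algebra_simps power2_eq_square numeral_eq_Suc)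
  also have "\<dots> = 0" unfolding sums(2,3) by (simp add: power2_eq_square power3_eq_cube)
  finally have "k a ^ 2 * (k a ^ 2 - 3 * int q) = 0" for a
    using sum_nonneg_eq_0_iff[of UNIV "\<lambda>a. k a ^ 2 * (k a ^ 2 - 3 * int q)"] nonneg by simp
  hence vals: "k a = 0 \<or> k a = 3 ^ m \<or> k a = - (3 ^ m)" for a
    unfolding q3 by (auto simp: power2_eq_iff)
  show ?thesis by (rule that[of k m]) (fact k vals m(2,3) sums(1,2) k0)+
qed

lemma W_distribution:
  shows "W ` (UNIV - {0}) = {0, of_real (sqrt (3 * real q)), - of_real (sqrt (3 * real q))}"
    and "real (card {a. a \<noteq> 0 \<and> W a = 0}) = real q - real q / 3 - 1"
    and "real (card {a. a \<noteq> 0 \<and> W a = of_real (sqrt (3 * real q))}) = (real q + sqrt (3 * real q)) / 6"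
    and "real (card {a. a \<noteq> 0 \<and> W a = - of_real (sqrt (3 * real q))}) = (real q - sqrt (3 * real q)) / 6"
proof -
  obtain k m where k: "\<And>a. W a = of_int (k a)" "\<And>a. k a = 0 \<or> k a = 3 ^ m \<or> k a = - (3 ^ m)"
    and s: "sqrt (3 * real q) = 3 ^ m" "3 * q = (3 ^ m) ^ 2"
    and sums: "(\<Sum>a\<in>UNIV. k a) = int q" "(\<Sum>a\<in>UNIV. k a ^ 2) = int q ^ 2" and k0: "k 0 = 0"
    by (rule W_values) fast
  define Z P M where "Z = {a. a \<noteq> 0 \<and> k a = 0}" and "P = {a. a \<noteq> 0 \<and> k a = 3 ^ m}"
    and "M = {a. a \<noteq> 0 \<and> k a = - (3 ^ m)}"
  have sets: "{a. a \<noteq> 0 \<and> W a = 0} = Z" "{a. a \<noteq> 0 \<and> W a = of_real (sqrt (3 * real q))} = P"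
    "{a. a \<noteq> 0 \<and> W a = - of_real (sqrt (3 * real q))} = M"
  proof -
    have "W a = of_real (sqrt (3 * real q)) \<longleftrightarrow> k a = 3 ^ m" for a
    proof -
      have "W a = of_real (sqrt (3 * real q)) \<longleftrightarrow> (of_int (k a) :: complex) = of_int (3 ^ m)" by (simp add: k(1) s)
      thus ?thesis by (simp only: of_int_eq_iff)
    qed
    moreover have "W a = - of_real (sqrt (3 * real q)) \<longleftrightarrow> k a = - (3 ^ m)" for a
    proof -
      have "W a = - of_real (sqrt (3 * real q)) \<longleftrightarrow> (of_int (k a) :: complex) = of_int (- (3 ^ m))" by (simp add: k(1) s)
      thus ?thesis by (simp only: of_int_eq_iff)
    qed
    ultimately show "{a. a \<noteq> 0 \<and> W a = 0} = Z" "{a. a \<noteq> 0 \<and> W a = of_real (sqrt (3 * real q))} = P"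
      "{a. a \<noteq> 0 \<and> W a = - of_real (sqrt (3 * real q))} = M"
      by (simp_all add: Z_def P_def M_def k(1))
  qed
  have pos: "(3::int) ^ m > 0" by simp
  have UNIV: "U = Z \<union> (P \<union> M)" using k(2) by (auto simp: Z_def P_def M_def)
  have disj: "Z \<inter> (P \<union> M) = {}" "P \<inter> M = {}" using pos by (auto simp: Z_def P_def M_def)
  \<comment> \<open>Applied to the identity and to the square, this turns the two moments into
    linear equations for the sizes of \<open>P\<close> and \<open>M\<close>.\<close>
  have sum: "(\<Sum>a\<in>UNIV. f (k a)) = f (3 ^ m) * int (card P) + f (- (3 ^ m)) * int (card M)"
    if "f 0 = 0" for f :: "int \<Rightarrow> int"
  proof -
    have "(\<Sum>a\<in>UNIV. f (k a)) = (\<Sum>a\<in>U. f (k a))"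
      by (subst sum.remove[of UNIV "0::'a"]) (simp_all add: k0 that)
    also have "\<dots> = (\<Sum>a\<in>Z. f (k a)) + ((\<Sum>a\<in>P. f (k a)) + (\<Sum>a\<in>M. f (k a)))"
      unfolding UNIV by (subst sum.union_disjoint) (simp_all add: disj sum.union_disjoint)
    also have "(\<Sum>a\<in>Z. f (k a)) = 0" by (simp add: Z_def that)
    also have "(\<Sum>a\<in>P. f (k a)) = f (3 ^ m) * int (card P)" by (simp add: P_def)
    also have "(\<Sum>a\<in>M. f (k a)) = f (- (3 ^ m)) * int (card M)" by (simp add: M_def)
    finally show ?thesis by simp
  qed
  define S where "S = (3::real) ^ m"
  have S: "S > 0" "3 * real q = S ^ 2" "sqrt (3 * real q) = S"
    using s arg_cong[OF s(2), of real] by (simp_all add: S_def)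
  have "3 ^ m * int (card P) - 3 ^ m * int (card M) = int q" using sum[of "\<lambda>x. x"] sums by simp
  hence "S * real (card P) - S * real (card M) = real q"
    unfolding S_def by (metis (mono_tags, lifting) of_int_diff of_int_mult of_int_numeral of_int_of_nat_eq of_int_power)
  \<comment> \<open>Because \<open>3 * q = S ^ 2\<close>, a factor \<open>S\<close> can be cancelled
    from the first moment.\<close>
  hence "S * (3 * real (card P) - 3 * real (card M)) = S * S"
    using S(2) by (simp add: algebra_simps power2_eq_square)
  hence diff: "3 * real (card P) - 3 * real (card M) = S" using S(1) by simp
  have "(3 ^ m) ^ 2 * int (card P) + (3 ^ m) ^ 2 * int (card M) = int q ^ 2"
    using sum[of "\<lambda>x. x ^ 2"] sums by simp
  moreover have "(3 ^ m) ^ 2 = 3 * int q" using arg_cong[OF s(2), of int] by simp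
  ultimately have "int q * (3 * int (card P) + 3 * int (card M)) = int q * int q"
    by (simp add: algebra_simps power2_eq_square)
  hence "3 * int (card P) + 3 * int (card M) = int q" using q_gt by simp
  hence add: "3 * real (card P) + 3 * real (card M) = real q" by linarith
  have solve: "p = (t + s) / 6" "m = (t - s) / 6" if "3 * p - 3 * m = s" "3 * p + 3 * m = t" for p m s t :: real
    using that by (auto simp: field_simps)
  have "card U = card Z + (card P + card M)"
    unfolding UNIV by (simp add: card_Un_disjoint disj)
  hence "q - 1 = card Z + (card P + card M)" by (simp add: card_Diff_subset card_field)
  hence Z: "real (card Z) = real q - 1 - real (card P) - real (card M)" using q_gt by linarith
  show "real (card {a. a \<noteq> 0 \<and> W a = 0}) = real q - real q / 3 - 1"
    unfolding sets using Z add by linarith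
  show "real (card {a. a \<noteq> 0 \<and> W a = of_real (sqrt (3 * real q))}) = (real q + sqrt (3 * real q)) / 6"
    unfolding sets unfolding S(3) using solve[OF diff add] by simp
  show "real (card {a. a \<noteq> 0 \<and> W a = - of_real (sqrt (3 * real q))}) = (real q - sqrt (3 * real q)) / 6"
    unfolding sets unfolding S(3) using solve[OF diff add] by simp
  \<comment> \<open>Needed for \<open>(q - S) / 6 > 0\<close>: all three classes must be inhabited
    for the image to be the full three-element set.\<close>
  have "S < real q"
  proof (rule ccontr)
    assume "\<not> S < real q"
    hence "real q * real q \<le> S * S" using S(1) by (intro mult_mono) auto
    hence "real q * real q \<le> 3 * real q" using S(2) by (simp add: power2_eq_square)
    thus False using q_gt by (simp add: mult_le_cancel_right)
  qed
  hence "real (card Z) > 0" "real (card P) > 0" "real (card M) > 0"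
    using Z add diff S(1) q_gt by linarith+
  hence "Z \<noteq> {}" "P \<noteq> {}" "M \<noteq> {}" by auto
  then obtain a b c where abc: "a \<in> Z" "b \<in> P" "c \<in> M" by blast
  define s :: complex where "s = of_real (sqrt (3 * real q))"
  note sets = sets[folded s_def]
  have "a \<in> U" "W a = 0" "b \<in> U" "W b = s" "c \<in> U" "W c = - s"
    using abc unfolding sets[symmetric] by auto
  hence "{0, s, - s} \<subseteq> W ` U" by (metis empty_subsetI image_eqI insert_subset)
  moreover have "W x \<in> {0, s, - s}" if "x \<in> U" for x
    using that unfolding UNIV sets[symmetric] by blast
  ultimately show "W ` (UNIV - {0}) = {0, of_real (sqrt (3 * real q)), - of_real (sqrt (3 * real q))}"
    unfolding s_def[symmetric] by blast
qed

end

theorem theorem2p3: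
  fixes n r d q :: nat
  assumes "CARD('a::{field,finite}) = q"
    and "q = 3 ^ n"
    and "odd n" and "n > 1"
    and "[4 * r = 1] (mod n)"
    and "d = 3 ^ r + 2"
  shows "(weil_sum d :: 'a \<Rightarrow> complex) ` (UNIV - {0}) =
           {0, of_real (sqrt (3 * real q)), - of_real (sqrt (3 * real q))}
       \<and> real (card {a :: 'a. a \<noteq> 0 \<and> weil_sum d a = 0}) = real q - real q / 3 - 1
       \<and> real (card {a :: 'a. a \<noteq> 0 \<and> weil_sum d a = of_real (sqrt (3 * real q))}) =
           (real q + sqrt (3 * real q)) / 6
       \<and> real (card {a :: 'a. a \<noteq> 0 \<and> weil_sum d a = - of_real (sqrt (3 * real q))}) =
           (real q - sqrt (3 * real q)) / 6"
proof -
  obtain c :: 'a where c: "c \<noteq> 0"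
    "\<And>f. ipoly f (cis (2 * pi / (3 * real (q - 1)))) = 0 \<Longrightarrow> ipoly f c = 0"
    using exists_residue[OF assms(1,2)] by blast
  interpret weil_exponent c n q r d
    by unfold_locales (use assms c in auto)
  show ?thesis using W_distribution by blast
qed

end
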